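(* Let $\mathbb{R}^3_+=\{x\in\mathbb{R}^3: x_3>0\}$ and let $(\mathbf{u},\mathbf{B})$ be a smooth axisymmetric self-similar solution in $\mathbb{R}^3_+$ to the stationary incompressible MHD equations without magnetic diffusion $$ \begin{cases} -\Delta \mathbf{u}+(\mathbf{u}\cdot\nabla)\mathbf{u}-(\mathbf{B}\cdot\nabla)\mathbf{B}+\nabla p=0,\\ (\mathbf{u}\cdot\nabla)\mathbf{B}=(\mathbf{B}\cdot\nabla)\mathbf{u},\\ \operatorname{div}\mathbf{u}=\operatorname{div}\mathbf{B}=0, \end{cases} $$ satisfying either the no-slip boundary condition $$\mathbf{u}=0,\qquad \mathbf{B}\cdot\mathbf{n}=0\qquad\text{on }\partial\mathbb{R}^3_+\setminus\{0\},$$ or the Navier slip boundary condition $$\mathbf{u}\cdot\mathbf{n}=0,\qquad (\mathbb{D}\mathbf{u}\cdot\mathbf{n})\cdot\boldsymbol{\tau}=0,\qquad \mathbf{B}\cdot\mathbf{n}=0\qquad\text{on }\partial\mathbb{R}^3_+\setminus\{0\},$$ where $\mathbf{n}$ is the unit outward normal vector on $\partial\mathbb{R}^3_+$, $\boldsymbol{\tau}$ is any unit tangent vector on $\partial\mathbb{R}^3_+$, and $\mathbb{D}\mathbf{u}=\frac12(\nabla\mathbf{u}+\nabla\mathbf{u}^T)$ is the strain tensor. Assume that $\mathbf{B}=\frac{B(\varphi)}{\rho}\,\mathbf{e}_\theta$ for some scalar function $B$ of $\varphi$, where $(\rho,\theta,\varphi)$ are spherical coordinates. Then $\mathbf{u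}=\mathbf{B}=0$.
   Context: **Spherical coordinates.** $(x_1,x_2,x_3)=(\rho\sin\varphi\cos\theta,\ \rho\sin\varphi\sin\theta,\ \rho\cos\varphi)$, with orthonormal basis vectors $\mathbf{e}_\rho=x/\rho$, $\mathbf{e}_\theta=(-\sin\theta,\cos\theta,0)$, $\mathbf{e}_\varphi=\mathbf{e}_\theta\times\mathbf{e}_\rho=(\cos\varphi\cos\theta,\cos\varphi\sin\theta,-\sin\varphi)$. The half-space $\mathbb{R}^3_+$ corresponds to $0\le\varphi<\pi/2$, $\rho>0$. **Axisymmetric.** A vector field $\mathbf{v}$ is axisymmetric if it has the form $\mathbf{v}=v^\rho(\rho,\varphi)\mathbf{e}_\rho+v^\theta(\rho,\varphi)\mathbf{e}_\theta+v^\varphi(\rho,\varphi)\mathbf{e}_\varphi$ (components independent of $\theta$; a nonzero swirl component $v^\theta$ is allowed). The solution $(\mathbf{u},\mathbf{B})$ is axisymmetric if both $\mathbf{u}$ and $\mathbf{B}$ are. **Solution, self-similar.** Here $\mathbf{u}$ (velocity) and $\mathbf{B}$ (magnetic field) are vector fields with values in $\mathbb{R}^3$, and $p$ (pressure) is the associated real-valued scalar function. The solution is self-similar if, for every $\lambda>0$ and all $x$ in the domain, $\mathbf{u}(x)=\lambda\mathbf{u}(\lambda x)$, $\mathbf{B}(x)=\lambda\mathbf{B}(\lambda x)$ and $p(x)=\lambda^2p(\lambda x)$. **Boundary conditions.** They are understood in the classical pointwise sense: $\mathbf{u}$ (and, for the Navier slip condition, also its first-order derivatives) extends continuously to $\overline{\mathbb{R}^3_+}\setminus\{0\}$,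 and so does $\mathbf{B}\cdot\mathbf{n}$; the conditions hold for these extensions. *)

theory Defs
  imports "HOL-Analysis.Analysis"
begin

text \<open>The differential operators below depend only on the germ of the function at the point; they are only ever
  evaluated at points of an open set on which the functions involved are smooth.\<close>

definition partial :: "3 \<Rightarrow> (real^3 \<Rightarrow> 'a::real_normed_vector) \<Rightarrow> real^3 \<Rightarrow> 'a" where
  "partial j f x = frechet_derivative f (at x) (axis j 1)"

text \<open>\<open>C\<close>-infinity on an open set \<open>S\<close>: every iterated partial derivative, of any order, exists and is
  (Frechet) differentiable at every point of \<open>S\<close>; continuity of all of them follows.\<close>

definition smooth_on :: "(real^3) set \<Rightarrow> (real^3 \<Rightarrow> 'a::real_normed_vector) \<Rightarrow> bool" where
  "smooth_on S f \<longleftrightarrow> (\<forall>js. \<forall>x\<in>S. foldr partial js f differentiable (at x))"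

definition laplacian :: "(real^3 \<Rightarrow> 'a::real_normed_vector) \<Rightarrow> real^3 \<Rightarrow> 'a" where
  "laplacian f x = (\<Sum>j\<in>UNIV. partial j (partial j f) x)"

definition grad :: "(real^3 \<Rightarrow> real) \<Rightarrow> real^3 \<Rightarrow> real^3" where
  "grad q x = (\<chi> j. partial j q x)"

definition divergence :: "(real^3 \<Rightarrow> real^3) \<Rightarrow> real^3 \<Rightarrow> real" where
  "divergence v x = (\<Sum>j\<in>UNIV. partial j v x $ j)"

definition convective :: "(real^3 \<Rightarrow> real^3) \<Rightarrow> (real^3 \<Rightarrow> real^3) \<Rightarrow> real^3 \<Rightarrow> real^3" where
  "convective v w x = (\<Sum>j\<in>UNIV. (v x $ j) *\<^sub>R partial j w x)"

text \<open>The strain tensor as a function of the velocity gradient, so that it can also be applied to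
  the boundary values of the gradient.\<close>

definition strain :: "real^3^3 \<Rightarrow> real^3^3" where
  "strain M = (1/2) *\<^sub>R (M + transpose M)"

definition half_space :: "(real^3) set" where
  "half_space = {x. x $ 3 > 0}"

definition outward_normal :: "real^3" where
  "outward_normal = vector [0, 0, -1]"

definition spherical :: "real \<Rightarrow> real \<Rightarrow> real \<Rightarrow> real^3" where
  "spherical \<rho> \<theta> \<phi> = vector [\<rho> * sin \<phi> * cos \<theta>, \<rho> * sin \<phi> * sin \<theta>, \<rho> * cos \<phi>]"

definition e_rho :: "real \<Rightarrow> real \<Rightarrow> real^3" where
  "e_rho \<theta> \<phi> = vector [sin \<phi> * cos \<theta>, sin \<phi> * sin \<theta>, cos \<phi>]"

definition e_theta :: "real \<Rightarrow> real^3" where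
  "e_theta \<theta> = vector [- sin \<theta>, cos \<theta>, 0]"

definition e_phi :: "real \<Rightarrow> real \<Rightarrow> real^3" where
  "e_phi \<theta> \<phi> = vector [cos \<phi> * cos \<theta>, cos \<phi> * sin \<theta>, - sin \<phi>]"

text \<open>The point \<open>spherical \<rho> \<theta> 0\<close> on the axis does not depend on \<open>\<theta>\<close> while \<open>e_theta\<close> and \<open>e_phi\<close> do, so
  requiring the representation there for every \<open>\<theta>\<close> says that the field is parallel to the axis
  on the axis.  For a continuous field this already follows from the representation off the axis.\<close>

definition axisymmetric :: "(real^3 \<Rightarrow> real^3) \<Rightarrow> bool" where
  "axisymmetric v \<longleftrightarrow>
    (\<exists>v\<^sub>\<rho> v\<^sub>\<theta> v\<^sub>\<phi> :: real \<Rightarrow> real \<Rightarrow> real.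
      \<forall>\<rho> \<theta> \<phi>. \<rho> > 0 \<and> 0 \<le> \<phi> \<and> \<phi> < pi / 2 \<longrightarrow>
        v (spherical \<rho> \<theta> \<phi>) =
          v\<^sub>\<rho> \<rho> \<phi> *\<^sub>R e_rho \<theta> \<phi> + v\<^sub>\<theta> \<rho> \<phi> *\<^sub>R e_theta \<theta> + v\<^sub>\<phi> \<rho> \<phi> *\<^sub>R e_phi \<theta> \<phi>)"

definition self_similar ::
  "(real^3 \<Rightarrow> real^3) \<Rightarrow> (real^3 \<Rightarrow> real^3) \<Rightarrow> (real^3 \<Rightarrow> real) \<Rightarrow> bool" where
  "self_similar u B p \<longleftrightarrow>
    (\<forall>c>0. \<forall>x\<in>half_space.
      u x = c *\<^sub>R u (c *\<^sub>R x) \<and> B x = c *\<^sub>R B (c *\<^sub>R x) \<and> p x = c^2 * p (c *\<^sub>R x))"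

definition stationary_mhd ::
  "(real^3 \<Rightarrow> real^3) \<Rightarrow> (real^3 \<Rightarrow> real^3) \<Rightarrow> (real^3 \<Rightarrow> real) \<Rightarrow> bool" where
  "stationary_mhd u B p \<longleftrightarrow>
    (\<forall>x\<in>half_space.
      - laplacian u x + convective u u x - convective B B x + grad p x = 0 \<and>
      convective u B x = convective B u x \<and>
      divergence u x = 0 \<and> divergence B x = 0)"

definition boundary :: "(real^3) set" where
  "boundary = frontier half_space - {0}"

definition extends_continuously_to ::
  "(real^3 \<Rightarrow> 'a::topological_space) \<Rightarrow> (real^3 \<Rightarrow> 'a) \<Rightarrow> bool" where
  "extends_continuously_to f F \<longleftrightarrow>
    continuous_on (closure half_space - {0}) F \<and> (\<forall>x\<in>half_space. F x = f x)"

definition vanishing_normal :: "(real^3 \<Rightarrow> real^3) \<Rightarrow> bool" where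
  "vanishing_normal B \<longleftrightarrow>
    (\<exists>\<beta>. extends_continuously_to (\<lambda>x. B x \<bullet> outward_normal) \<beta> \<and> (\<forall>x\<in>boundary. \<beta> x = 0))"

definition no_slip :: "(real^3 \<Rightarrow> real^3) \<Rightarrow> (real^3 \<Rightarrow> real^3) \<Rightarrow> bool" where
  "no_slip u B \<longleftrightarrow>
    (\<exists>U. extends_continuously_to u U \<and> (\<forall>x\<in>boundary. U x = 0)) \<and>
    vanishing_normal B"

definition navier_slip :: "(real^3 \<Rightarrow> real^3) \<Rightarrow> (real^3 \<Rightarrow> real^3) \<Rightarrow> bool" where
  "navier_slip u B \<longleftrightarrow>
    (\<exists>U G. extends_continuously_to u U \<and> extends_continuously_to (\<lambda>x. jacobian u (at x)) G \<and>
      (\<forall>x\<in>boundary. U x \<bullet> outward_normal = 0 \<and>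
        (\<forall>\<tau>. norm \<tau> = 1 \<and> \<tau> \<bullet> outward_normal = 0 \<longrightarrow>
          (strain (G x) *v outward_normal) \<bullet> \<tau> = 0))) \<and>
    vanishing_normal B"

end

theory Submission
  imports Defs
begin

text \<open>
An axisymmetric field that is homogeneous of degree \<open>-1\<close> is determined by three functions of the polar
angle \<open>\<phi>\<close>: write \<open>u = (f e_rho + g e_theta + h e_phi) / \<rho>\<close>, \<open>B = b e_theta / \<rho>\<close> and \<open>p = P / \<rho>\<^sup>2\<close>.
The equations become ordinary differential equations on \<open>0 < \<phi> < pi / 2\<close>, with the axis at \<open>\<phi> = 0\<close> and
the boundary of the half space at \<open>\<phi> = pi / 2\<close> (lemmas \<open>profile_derivatives\<close> and
\<open>mhd_profile_equations\<close>).  Three facts then finish the proof.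

The swirl \<open>g\<close> obeys a linear equation of the first order for \<open>(g sin \<phi>)' / sin \<phi>\<close>, whose boundary
conditions leave only zero (\<open>swirl_vanishes\<close>).  The magnetic field does not enter it, since the Lorentz force of
a purely azimuthal field has no azimuthal component.

The induction equation together with incompressibility says that \<open>h\<^sup>2 b sin \<phi>\<close> is constant, hence zero by its
value on the axis.  Where \<open>b \<noteq> 0\<close> the fluid is therefore at rest, and the magnetic tension has to be balanced
by the pressure alone; this is possible only if \<open>b sin \<phi>\<close> has constant square, and smoothness on the axis makes
that constant zero (\<open>magnetic_profile_vanishes\<close>).

What remains is a flow without swirl and magnetic field.  Its equation can be integrated to a
Riccati equation for the stream function, with a single constant because of regularity on the axis.  Both
boundary conditions make the constant zero, and a Riccati equation without inhomogeneity and with zero data has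
only the zero solution (\<open>meridional_flow_vanishes\<close>).
\<close>

section \<open>Derivatives along curves\<close>

text \<open>For a differentiable \<open>f\<close> this is the derivative of \<open>f\<close> applied to \<open>a\<close>; the formula through the partial
derivatives can itself be differentiated along a curve, and \<open>convective v w x\<close> is literally
\<open>directional (v x) w x\<close>.\<close>
definition directional :: "real^3 \<Rightarrow> (real^3 \<Rightarrow> 'a::real_normed_vector) \<Rightarrow> real^3 \<Rightarrow> 'a" where
  "directional a f x = (\<Sum>j\<in>UNIV. (a $ j) *\<^sub>R partial j f x)"

text \<open>The second derivative at \<open>x\<close> along the straight line with velocity \<open>a\<close>.\<close>
definition hessian_form :: "real^3 \<Rightarrow> (real^3 \<Rightarrow> 'a::real_normed_vector) \<Rightarrow> real^3 \<Rightarrow> 'a" where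
  "hessian_form a f x = (\<Sum>j\<in>UNIV. (a $ j) *\<^sub>R directional a (partial j f) x)"

lemma smooth_on_differentiable: "smooth_on S f \<Longrightarrow> x \<in> S \<Longrightarrow> f differentiable (at x)"
  unfolding smooth_on_def by (metis foldr_Nil id_apply)

lemma smooth_on_partial: "smooth_on S f \<Longrightarrow> smooth_on S (partial j f)"
  unfolding smooth_on_def
proof (intro allI ballI)
  fix js x assume "\<forall>js. \<forall>x\<in>S. foldr partial js f differentiable at x" "x \<in> S"
  then have "foldr partial (js @ [j]) f differentiable at x" by blast
  then show "foldr partial js (partial j f) differentiable at x" by simp
qed

lemma directional_eq_frechet_derivative:
  assumes "f differentiable (at x)"
  shows "directional a f x = frechet_derivative f (at x) a"
proof -
  have lin: "linear (frechet_derivative f (at x))"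
    using assms by (rule linear_frechet_derivative)
  have "frechet_derivative f (at x) a
      = frechet_derivative f (at x) (\<Sum>j\<in>UNIV. (a $ j) *\<^sub>R axis j 1)"
    using basis_expansion[of a] by (simp add: scalar_mult_eq_scaleR)
  also have "\<dots> = directional a f x"
    by (simp add: linear_sum[OF lin] linear_scale[OF lin] directional_def partial_def)
  finally show ?thesis by simp
qed

lemma curve_derivative:
  assumes "f differentiable (at (x t))" and "(x has_vector_derivative x') (at t)"
  shows "((\<lambda>t. f (x t)) has_vector_derivative directional x' f (x t)) (at t)"
proof -
  have "(f has_derivative frechet_derivative f (at (x t))) (at (x t))"
    using assms(1) frechet_derivative_works by blast
  then have "(f has_derivative frechet_derivative f (at (x t))) (at (x t) within range x)"
    by (rule has_derivative_at_withinI)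
  from vector_derivative_diff_chain_within[OF assms(2) this]
  show ?thesis using directional_eq_frechet_derivative[OF assms(1)] by (simp add: o_def)
qed

lemma curve_second_derivative:
  assumes S: "smooth_on S f" "x t \<in> S"
    and x': "(x has_vector_derivative x' t) (at t)"
    and x'': "(x' has_vector_derivative x'') (at t)"
  shows "((\<lambda>t. directional (x' t) f (x t)) has_vector_derivative
           directional x'' f (x t) + hessian_form (x' t) f (x t)) (at t)"
proof -
  have c: "((\<lambda>t. x' t $ j) has_real_derivative x'' $ j) (at t)" for j
    using bounded_linear.has_vector_derivative[OF bounded_linear_vec_nth x'']
    by (simp add: has_real_derivative_iff_has_vector_derivative)
  have d: "((\<lambda>t. partial j f (x t)) has_vector_derivative directional (x' t) (partial j f) (x t)) (at t)" for j
    by (intro curve_derivative x' smooth_on_differentiable[OF smooth_on_partial[OF S(1)] S(2)])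
  have "((\<lambda>t. \<Sum>j\<in>UNIV. (x' t $ j) *\<^sub>R partial j f (x t)) has_vector_derivative
     (\<Sum>j\<in>UNIV. (x' t $ j) *\<^sub>R directional (x' t) (partial j f) (x t) + (x'' $ j) *\<^sub>R partial j f (x t))) (at t)"
    by (intro has_vector_derivative_sum has_vector_derivative_scaleR c d)
  then show ?thesis
    by (simp add: directional_def hessian_form_def sum.distrib add.commute)
qed

text \<open>If the values of \<open>f\<close> along a curve are known explicitly, then so are the first and, up to the curvature
term \<open>directional x'' f\<close>, the second derivative of \<open>f\<close> in the direction of the curve.  Along the three
coordinate curves of the spherical system the symmetries of the solution make the values explicit, and
this is how all partial derivatives in the equations are turned into derivatives of functions of the
polar angle.\<close>
lemma derivatives_along_curve:
  assumes f: "smooth_on S f" and I: "open I" "t \<in> I"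
    and x: "\<And>t. t \<in> I \<Longrightarrow> x t \<in> S"
    and x': "\<And>t. t \<in> I \<Longrightarrow> (x has_vector_derivative x' t) (at t)"
    and x'': "(x' has_vector_derivative x'') (at t)"
    and y: "\<And>t. t \<in> I \<Longrightarrow> f (x t) = y t"
    and y': "\<And>t. t \<in> I \<Longrightarrow> (y has_vector_derivative y' t) (at t)"
    and y'': "(y' has_vector_derivative y'') (at t)"
  shows "directional (x' t) f (x t) = y' t"
    and "directional x'' f (x t) + hessian_form (x' t) f (x t) = y''"
proof -
  have 1: "directional (x' s) f (x s) = y' s" if "s \<in> I" for s
  proof -
    have "((\<lambda>t. f (x t)) has_vector_derivative directional (x' s) f (x s)) (at s)"
      using that by (intro curve_derivative smooth_on_differentiable[OF f] x x')
    then have "(y has_vector_derivative directional (x' s) f (x s)) (at s)"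
      by (rule has_vector_derivative_transform_within_open[OF _ I(1) that]) (rule y)
    with y'[OF that] show ?thesis by (metis vector_derivative_unique_at)
  qed
  then show "directional (x' t) f (x t) = y' t" using I by blast
  have "((\<lambda>t. directional (x' t) f (x t)) has_vector_derivative
           directional x'' f (x t) + hessian_form (x' t) f (x t)) (at t)"
    using I by (intro curve_second_derivative[OF f] x x' x'')
  then have "(y' has_vector_derivative directional x'' f (x t) + hessian_form (x' t) f (x t)) (at t)"
    by (rule has_vector_derivative_transform_within_open[OF _ I]) (rule 1)
  with y'' show "directional x'' f (x t) + hessian_form (x' t) f (x t) = y''"
    by (metis vector_derivative_unique_at)
qed

lemma directional_add: "directional (a + b) f x = directional a f x + directional b f x"
  by (simp add: directional_def scaleR_add_left sum.distrib)

lemma directional_scaleR: "directional (r *\<^sub>R a) f x = r *\<^sub>R directional a f x"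
  by (simp add: directional_def scaleR_sum_right)

lemma directional_minus: "directional (- a) f x = - directional a f x"
  using directional_scaleR[of "-1" a] by simp

lemma convective_eq_directional: "convective v w x = directional (v x) w x"
  by (simp add: convective_def directional_def)

lemma inner_grad: "a \<bullet> grad q x = directional a q x"
  by (simp add: directional_def grad_def inner_vec_def)

section \<open>The spherical frame\<close>

text \<open>The vector with components \<open>a\<close>, \<open>b\<close>, \<open>c\<close> in the orthonormal basis of the spherical coordinates at
\<open>(\<theta>, \<phi>)\<close>.\<close>
definition frame :: "real \<Rightarrow> real \<Rightarrow> real \<Rightarrow> real \<Rightarrow> real \<Rightarrow> real^3" where
  "frame \<theta> \<phi> a b c = a *\<^sub>R e_rho \<theta> \<phi> + b *\<^sub>R e_theta \<theta> + c *\<^sub>R e_phi \<theta> \<phi>"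

lemma frame_add: "frame \<theta> \<phi> a b c + frame \<theta> \<phi> a' b' c' = frame \<theta> \<phi> (a + a') (b + b') (c + c')"
  by (simp add: frame_def algebra_simps)

lemma frame_scaleR: "r *\<^sub>R frame \<theta> \<phi> a b c = frame \<theta> \<phi> (r * a) (r * b) (r * c)"
  by (simp add: frame_def algebra_simps)

lemma frame_minus: "- frame \<theta> \<phi> a b c = frame \<theta> \<phi> (- a) (- b) (- c)"
  by (simp add: frame_def algebra_simps)

lemma frame_diff: "frame \<theta> \<phi> a b c - frame \<theta> \<phi> a' b' c' = frame \<theta> \<phi> (a - a') (b - b') (c - c')"
  by (simp add: frame_def algebra_simps)

lemma frame_nth:
  "frame \<theta> \<phi> a b c $ 1 = a * (sin \<phi> * cos \<theta>) - b * sin \<theta> + c * (cos \<phi> * cos \<theta>)"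
  "frame \<theta> \<phi> a b c $ 2 = a * (sin \<phi> * sin \<theta>) + b * cos \<theta> + c * (cos \<phi> * sin \<theta>)"
  "frame \<theta> \<phi> a b c $ 3 = a * cos \<phi> - c * sin \<phi>"
  by (simp_all add: frame_def e_rho_def e_theta_def e_phi_def vector_3)

lemma e_as_frame: "e_rho \<theta> \<phi> = frame \<theta> \<phi> 1 0 0" "e_theta \<theta> = frame \<theta> \<phi> 0 1 0"
    "e_phi \<theta> \<phi> = frame \<theta> \<phi> 0 0 1"
  by (simp_all add: frame_def)

lemma frame_orthonormal:
  "e_rho \<theta> \<phi> \<bullet> e_rho \<theta> \<phi> = 1" "e_theta \<theta> \<bullet> e_theta \<theta> = 1" "e_phi \<theta> \<phi> \<bullet> e_phi \<theta> \<phi> = 1"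
  "e_rho \<theta> \<phi> \<bullet> e_theta \<theta> = 0" "e_rho \<theta> \<phi> \<bullet> e_phi \<theta> \<phi> = 0" "e_theta \<theta> \<bullet> e_phi \<theta> \<phi> = 0"
proof -
  have s: "sin x ^ 2 = 1 - cos x ^ 2" for x :: real by (simp add: sin_squared_eq)
  note d = e_rho_def e_theta_def e_phi_def inner_vec_def sum_3 vector_3
  have "sin \<phi> * cos \<theta> * (sin \<phi> * cos \<theta>) + sin \<phi> * sin \<theta> * (sin \<phi> * sin \<theta>) + cos \<phi> * cos \<phi> = 1"
    using s[of \<phi>] s[of \<theta>] by algebra
  then show "e_rho \<theta> \<phi> \<bullet> e_rho \<theta> \<phi> = 1" by (simp add: d)
  have "sin \<theta> * sin \<theta> + cos \<theta> * cos \<theta> = 1" using s[of \<theta>] by algebra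
  then show "e_theta \<theta> \<bullet> e_theta \<theta> = 1" by (simp add: d)
  have "cos \<phi> * cos \<theta> * (cos \<phi> * cos \<theta>) + cos \<phi> * sin \<theta> * (cos \<phi> * sin \<theta>) + sin \<phi> * sin \<phi> = 1"
    using s[of \<phi>] s[of \<theta>] by algebra
  then show "e_phi \<theta> \<phi> \<bullet> e_phi \<theta> \<phi> = 1" by (simp add: d)
  show "e_rho \<theta> \<phi> \<bullet> e_theta \<theta> = 0" by (simp add: d algebra_simps)
  show "e_theta \<theta> \<bullet> e_phi \<theta> \<phi> = 0" by (simp add: d algebra_simps)
  have "sin \<phi> * cos \<theta> * (cos \<phi> * cos \<theta>) + sin \<phi> * sin \<theta> * (cos \<phi> * sin \<theta>) - cos \<phi> * sin \<phi> = 0"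
    using s[of \<phi>] s[of \<theta>] by algebra
  then show "e_rho \<theta> \<phi> \<bullet> e_phi \<theta> \<phi> = 0" by (simp add: d)
qed

lemma inner_frame:
  "e_rho \<theta> \<phi> \<bullet> frame \<theta> \<phi> a b c = a" "e_theta \<theta> \<bullet> frame \<theta> \<phi> a b c = b" "e_phi \<theta> \<phi> \<bullet> frame \<theta> \<phi> a b c = c"
  by (simp_all add: frame_def inner_add_right frame_orthonormal
       frame_orthonormal[unfolded inner_commute[of "e_rho \<theta> \<phi>"] inner_commute[of "e_theta \<theta>"]]
       inner_commute[of "e_theta \<theta>" "e_rho \<theta> \<phi>"] inner_commute[of "e_phi \<theta> \<phi>" "e_rho \<theta> \<phi>"]
       inner_commute[of "e_phi \<theta> \<phi>" "e_theta \<theta>"])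

lemma frame_eq_iff: "frame \<theta> \<phi> a b c = frame \<theta> \<phi> a' b' c' \<longleftrightarrow> a = a' \<and> b = b' \<and> c = c'"
  by (metis inner_frame)

text \<open>An orthonormal basis resolves the identity matrix.  Hence traces, such as the Laplacian and the
divergence, may be computed in the moving frame instead of the Cartesian one.\<close>
lemma frame_complete:
  "e_rho \<theta> \<phi> $ i * e_rho \<theta> \<phi> $ j + e_theta \<theta> $ i * e_theta \<theta> $ j + e_phi \<theta> \<phi> $ i * e_phi \<theta> \<phi> $ j
    = (if i = j then 1 else 0)"
proof -
  have s: "sin x ^ 2 = 1 - cos x ^ 2" for x :: real by (simp add: sin_squared_eq)
  note d = e_rho_def e_theta_def e_phi_def vector_3
  have "\<forall>i j. e_rho \<theta> \<phi> $ i * e_rho \<theta> \<phi> $ j + e_theta \<theta> $ i * e_theta \<theta> $ j + e_phi \<theta> \<phi> $ i * e_phi \<theta> \<phi> $ j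
    = (if i = j then 1 else 0)"
    unfolding forall_3 d using s[of \<phi>] s[of \<theta>] by simp algebra
  then show ?thesis by blast
qed

lemma frame_expansion: "v = frame \<theta> \<phi> (e_rho \<theta> \<phi> \<bullet> v) (e_theta \<theta> \<bullet> v) (e_phi \<theta> \<phi> \<bullet> v)"
proof -
  have "frame \<theta> \<phi> (e_rho \<theta> \<phi> \<bullet> v) (e_theta \<theta> \<bullet> v) (e_phi \<theta> \<phi> \<bullet> v) $ i
     = (\<Sum>j\<in>UNIV. (e_rho \<theta> \<phi> $ i * e_rho \<theta> \<phi> $ j + e_theta \<theta> $ i * e_theta \<theta> $ j + e_phi \<theta> \<phi> $ i * e_phi \<theta> \<phi> $ j) * v $ j)" for i
    by (simp add: frame_def inner_vec_def sum_distrib_left sum_distrib_right sum.distrib algebra_simps)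
  then show ?thesis by (simp add: frame_complete vec_eq_iff if_distrib if_distribR cong: if_cong)
qed

lemma laplacian_frame:
  "laplacian f x = hessian_form (e_rho \<theta> \<phi>) f x + hessian_form (e_theta \<theta>) f x + hessian_form (e_phi \<theta> \<phi>) f x"
proof -
  have "hessian_form (e_rho \<theta> \<phi>) f x + hessian_form (e_theta \<theta>) f x + hessian_form (e_phi \<theta> \<phi>) f x
    = (\<Sum>j\<in>UNIV. \<Sum>i\<in>UNIV. (e_rho \<theta> \<phi> $ j * e_rho \<theta> \<phi> $ i + e_theta \<theta> $ j * e_theta \<theta> $ i + e_phi \<theta> \<phi> $ j * e_phi \<theta> \<phi> $ i)
        *\<^sub>R partial i (partial j f) x)"
    by (simp add: hessian_form_def directional_def scaleR_sum_right sum.distrib scaleR_add_left)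
  also have "\<dots> = laplacian f x"
    by (simp add: frame_complete laplacian_def if_distrib if_distribR cong: if_cong)
  finally show ?thesis by simp
qed

lemma divergence_frame:
  "divergence v x = e_rho \<theta> \<phi> \<bullet> directional (e_rho \<theta> \<phi>) v x + e_theta \<theta> \<bullet> directional (e_theta \<theta>) v x
     + e_phi \<theta> \<phi> \<bullet> directional (e_phi \<theta> \<phi>) v x"
proof -
  have "e_rho \<theta> \<phi> \<bullet> directional (e_rho \<theta> \<phi>) v x + e_theta \<theta> \<bullet> directional (e_theta \<theta>) v x
     + e_phi \<theta> \<phi> \<bullet> directional (e_phi \<theta> \<phi>) v x
    = (\<Sum>i\<in>UNIV. \<Sum>j\<in>UNIV. (e_rho \<theta> \<phi> $ i * e_rho \<theta> \<phi> $ j + e_theta \<theta> $ i * e_theta \<theta> $ j + e_phi \<theta> \<phi> $ i * e_phi \<theta> \<phi> $ j)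
        * partial j v x $ i)"
    by (simp add: inner_vec_def directional_def sum_distrib_left sum.distrib algebra_simps)
  also have "\<dots> = divergence v x"
    by (simp add: frame_complete divergence_def if_distrib if_distribR cong: if_cong)
  finally show ?thesis by simp
qed

lemma vector3_has_vector_derivative:
  assumes "(a has_real_derivative a') F" "(b has_real_derivative b') F" "(c has_real_derivative c') F"
  shows "((\<lambda>t. vector [a t, b t, c t] :: real^3) has_vector_derivative vector [a', b', c']) F"
proof -
  have e: "(vector [p, q, r] :: real^3) = p *\<^sub>R axis 1 1 + q *\<^sub>R axis 2 1 + r *\<^sub>R axis 3 1" for p q r
    by (simp add: vec_eq_iff forall_3 vector_3 axis_def)
  show ?thesis unfolding e
    by (intro has_vector_derivative_add bounded_linear.has_vector_derivative[OF bounded_linear_scaleR_left]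
          assms[unfolded has_real_derivative_iff_has_vector_derivative])
qed

text \<open>Moving along the meridian turns \<open>e_rho\<close> into \<open>e_phi\<close> and \<open>e_phi\<close> into \<open>- e_rho\<close>; this rotation of the
frame produces the terms without a derivative.\<close>
lemma frame_derivative_phi:
  assumes "(a has_real_derivative a') (at \<phi>)" "(b has_real_derivative b') (at \<phi>)" "(c has_real_derivative c') (at \<phi>)"
  shows "((\<lambda>\<phi>. frame \<theta> \<phi> (a \<phi>) (b \<phi>) (c \<phi>)) has_vector_derivative
           frame \<theta> \<phi> (a' - c \<phi>) b' (a \<phi> + c')) (at \<phi>)"
proof -
  have e: "frame \<theta> \<phi> a b c = vector [a * (sin \<phi> * cos \<theta>) - b * sin \<theta> + c * (cos \<phi> * cos \<theta>),
     a * (sin \<phi> * sin \<theta>) + b * cos \<theta> + c * (cos \<phi> * sin \<theta>), a * cos \<phi> - c * sin \<phi>]" for \<theta> \<phi> a b c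
    by (simp add: vec_eq_iff forall_3 frame_nth vector_3)
  show ?thesis unfolding e
    by (rule has_vector_derivative_eq_rhs, rule vector3_has_vector_derivative;
        (rule derivative_eq_intros assms refl)+) (simp_all add: algebra_simps)
qed

text \<open>Rotation about the axis at unit speed; the vector \<open>sin \<phi> e_rho + cos \<phi> e_phi\<close> hidden in the right-hand side
is the horizontal unit vector pointing away from the axis.\<close>
lemma frame_derivative_theta:
  "((\<lambda>\<theta>. frame \<theta> \<phi> a b c) has_vector_derivative
     frame \<theta> \<phi> (- b * sin \<phi>) (a * sin \<phi> + c * cos \<phi>) (- b * cos \<phi>)) (at \<theta>)"
proof -
  have s: "sin \<phi> ^ 2 = 1 - cos \<phi> ^ 2" by (simp add: sin_squared_eq)
  have e: "frame \<theta> \<phi> a b c = vector [a * (sin \<phi> * cos \<theta>) - b * sin \<theta> + c * (cos \<phi> * cos \<theta>),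
     a * (sin \<phi> * sin \<theta>) + b * cos \<theta> + c * (cos \<phi> * sin \<theta>), a * cos \<phi> - c * sin \<phi>]" for \<theta> \<phi> a b c
    by (simp add: vec_eq_iff forall_3 frame_nth vector_3)
  have 1: "((\<lambda>\<theta>. frame \<theta> \<phi> a b c) has_vector_derivative
     vector [- a * (sin \<phi> * sin \<theta>) - b * cos \<theta> - c * (cos \<phi> * sin \<theta>),
       a * (sin \<phi> * cos \<theta>) - b * sin \<theta> + c * (cos \<phi> * cos \<theta>), 0]) (at \<theta>)"
    unfolding e
    by (rule has_vector_derivative_eq_rhs, rule vector3_has_vector_derivative;
        (rule derivative_eq_intros refl)+) (simp_all add: algebra_simps)
  have 2: "vector [- a * (sin \<phi> * sin \<theta>) - b * cos \<theta> - c * (cos \<phi> * sin \<theta>),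
       a * (sin \<phi> * cos \<theta>) - b * sin \<theta> + c * (cos \<phi> * cos \<theta>), 0]
    = frame \<theta> \<phi> (- b * sin \<phi>) (a * sin \<phi> + c * cos \<phi>) (- b * cos \<phi>)"
    unfolding vec_eq_iff forall_3 frame_nth vector_3 using s by algebra
  show ?thesis using 1 unfolding 2 .
qed

section \<open>Axisymmetric fields of degree minus one\<close>

lemma e_rho_derivative_phi: "(e_rho \<theta> has_vector_derivative e_phi \<theta> \<phi>) (at \<phi>)"
  using frame_derivative_phi[of "\<lambda>_. 1" 0 \<phi> "\<lambda>_. 0" 0 "\<lambda>_. 0" 0 \<theta>]
  by (simp add: frame_def)

lemma e_phi_derivative_phi: "(e_phi \<theta> has_vector_derivative - e_rho \<theta> \<phi>) (at \<phi>)"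
  using frame_derivative_phi[of "\<lambda>_. 0" 0 \<phi> "\<lambda>_. 0" 0 "\<lambda>_. 1" 0 \<theta>]
  by (simp add: frame_def)

lemma spherical_eq_e_rho: "spherical \<rho> \<theta> \<phi> = \<rho> *\<^sub>R e_rho \<theta> \<phi>"
  by (simp add: vec_eq_iff forall_3 spherical_def e_rho_def vector_3)

lemma open_half_space: "open half_space"
  unfolding half_space_def by (rule open_halfspace_component_gt_cart)

lemma scaleR_half_space: "x \<in> half_space \<Longrightarrow> r > 0 \<Longrightarrow> r *\<^sub>R x \<in> half_space"
  by (simp add: half_space_def)

lemma e_rho_half_space: "- (pi / 2) < \<phi> \<Longrightarrow> \<phi> < pi / 2 \<Longrightarrow> e_rho \<theta> \<phi> \<in> half_space"
  by (simp add: half_space_def e_rho_def vector_3 cos_gt_zero_pi)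

lemma half_space_spherical:
  assumes "x \<in> half_space"
  obtains \<rho> \<theta> \<phi> where "\<rho> > 0" "0 \<le> \<phi>" "\<phi> < pi / 2" "x = spherical \<rho> \<theta> \<phi>"
proof -
  define r where "r = sqrt (x$1^2 + x$2^2)"
  define \<rho> where "\<rho> = sqrt (r^2 + x$3^2)"
  have x3: "x $ 3 > 0" using assms by (simp add: half_space_def)
  have r0: "r \<ge> 0" and r2: "r^2 = x$1^2 + x$2^2" by (simp_all add: r_def)
  have \<rho>0: "\<rho> > 0" and \<rho>2: "\<rho>^2 = r^2 + x$3^2" using x3 by (simp_all add: \<rho>_def add_nonneg_pos)
  obtain \<theta> where \<theta>: "x $ 1 = r * cos \<theta>" "x $ 2 = r * sin \<theta>"
  proof (cases "r = 0")
    case True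
    then show ?thesis using r2 that[of 0] by (simp add: sum_power2_eq_zero_iff)
  next
    case False
    have "(x$1 / r)^2 + (x$2 / r)^2 = r^2 / r^2"
      unfolding power_divide add_divide_distrib[symmetric] r2 ..
    with False have "(x$1 / r)^2 + (x$2 / r)^2 = 1" by simp
    then obtain t where "x$1 / r = cos t" "x$2 / r = sin t" using sincos_total_2pi by metis
    then show ?thesis using that[of t] False by (simp add: field_simps)
  qed
  have "(x$3 / \<rho>)^2 + (r / \<rho>)^2 = \<rho>^2 / \<rho>^2"
    unfolding power_divide add_divide_distrib[symmetric] \<rho>2 by (simp add: add.commute)
  with \<rho>0 have "(x$3 / \<rho>)^2 + (r / \<rho>)^2 = 1" by simp
  moreover have "0 \<le> x$3 / \<rho>" "0 \<le> r / \<rho>" using x3 r0 \<rho>0 by auto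
  ultimately obtain \<phi> where \<phi>: "0 \<le> \<phi>" "\<phi> \<le> pi / 2" "x$3 / \<rho> = cos \<phi>" "r / \<rho> = sin \<phi>"
    using sincos_total_pi_half by metis
  have "cos \<phi> \<noteq> 0" using x3 \<rho>0 by (simp flip: \<phi>(3))
  then have "\<phi> \<noteq> pi / 2" using cos_pi_half by metis
  moreover have "x = spherical \<rho> \<theta> \<phi>"
    using \<phi>(3,4) \<theta> \<rho>0 by (simp add: vec_eq_iff forall_3 spherical_def vector_3 field_simps)
  ultimately show ?thesis using that \<rho>0 \<phi> by (metis order_le_less)
qed

lemma hessian_form_scaleR: "hessian_form (r *\<^sub>R a) f x = r\<^sup>2 *\<^sub>R hessian_form a f x"
  by (simp add: hessian_form_def directional_scaleR scaleR_sum_right power2_eq_square mult_ac)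

text \<open>Axisymmetry together with homogeneity of degree \<open>-1\<close>, in terms of the components on the unit half
sphere as functions of the polar angle.\<close>
definition has_profile :: "(real^3 \<Rightarrow> real^3) \<Rightarrow> (real \<Rightarrow> real) \<Rightarrow> (real \<Rightarrow> real) \<Rightarrow> (real \<Rightarrow> real) \<Rightarrow> bool" where
  "has_profile v f g h \<longleftrightarrow> (\<forall>\<rho> \<theta> \<phi>. \<rho> > 0 \<and> 0 \<le> \<phi> \<and> \<phi> < pi / 2 \<longrightarrow>
     v (spherical \<rho> \<theta> \<phi>) = (1 / \<rho>) *\<^sub>R frame \<theta> \<phi> (f \<phi>) (g \<phi>) (h \<phi>))"

definition twice_differentiable_with :: "(real \<Rightarrow> real) \<Rightarrow> (real \<Rightarrow> real) \<Rightarrow> (real \<Rightarrow> real) \<Rightarrow> bool" where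
  "twice_differentiable_with f f1 f2 \<longleftrightarrow> (\<forall>\<phi>\<in>{0<..<pi/2}.
     (f has_real_derivative f1 \<phi>) (at \<phi>) \<and> (f1 has_real_derivative f2 \<phi>) (at \<phi>))"

lemma profile_on_sphere:
  "has_profile v f g h \<Longrightarrow> 0 \<le> \<phi> \<Longrightarrow> \<phi> < pi / 2 \<Longrightarrow> v (e_rho \<theta> \<phi>) = frame \<theta> \<phi> (f \<phi>) (g \<phi>) (h \<phi>)"
  unfolding has_profile_def using spherical_eq_e_rho[of 1 \<theta> \<phi>] by (metis div_by_1 scaleR_one zero_less_one)

text \<open>The spherical form of the gradient and the Laplacian of such a field, on the unit sphere.  The values of
the field are explicit along the ray (homogeneity), along the parallel (axisymmetry) and along the
meridian (by the profile), so that \<open>derivatives_along_curve\<close> applies to the three coordinate curves.  The rates of change are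
the frame vectors, up to the factor \<open>sin \<phi>\<close> for the parallel, and the Laplacian is the sum of the three
second derivatives.  The azimuth \<open>\<theta>\<close> stays arbitrary because the pressure is not known in advance to be
axisymmetric.\<close>
lemma profile_derivatives:
  assumes sm: "smooth_on half_space v" and pr: "has_profile v f g h"
    and \<phi>: "\<phi> \<in> {0<..<pi/2}"
    and d: "twice_differentiable_with f f1 f2" "twice_differentiable_with g g1 g2"
      "twice_differentiable_with h h1 h2"
  shows "directional (e_rho \<theta> \<phi>) v (e_rho \<theta> \<phi>) = frame \<theta> \<phi> (- f \<phi>) (- g \<phi>) (- h \<phi>)" (is ?rho)
    and "directional (e_theta \<theta>) v (e_rho \<theta> \<phi>)
      = (1 / sin \<phi>) *\<^sub>R frame \<theta> \<phi> (- g \<phi> * sin \<phi>) (f \<phi> * sin \<phi> + h \<phi> * cos \<phi>) (- g \<phi> * cos \<phi>)" (is ?theta)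
    and "directional (e_phi \<theta> \<phi>) v (e_rho \<theta> \<phi>) = frame \<theta> \<phi> (f1 \<phi> - h \<phi>) (g1 \<phi>) (f \<phi> + h1 \<phi>)" (is ?phi)
    and "(sin \<phi>)\<^sup>2 *\<^sub>R laplacian v (e_rho \<theta> \<phi>) = frame \<theta> \<phi>
      ((sin \<phi>)\<^sup>2 * f2 \<phi> + sin \<phi> * cos \<phi> * f1 \<phi> - 2 * (sin \<phi>)\<^sup>2 * f \<phi>
         - 2 * sin \<phi> * cos \<phi> * h \<phi> - 2 * (sin \<phi>)\<^sup>2 * h1 \<phi>)
      ((sin \<phi>)\<^sup>2 * g2 \<phi> + sin \<phi> * cos \<phi> * g1 \<phi> - g \<phi>)
      ((sin \<phi>)\<^sup>2 * h2 \<phi> + sin \<phi> * cos \<phi> * h1 \<phi> + 2 * (sin \<phi>)\<^sup>2 * f1 \<phi> - h \<phi>)" (is ?lap)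
proof -
  let ?x = "e_rho \<theta> \<phi>" and ?s = "sin \<phi>" and ?c = "cos \<phi>"
  let ?f = "f \<phi>" and ?g = "g \<phi>" and ?h = "h \<phi>"
  have s0: "?s > 0" using \<phi> by (intro sin_gt_zero) auto
  have mem: "e_rho t \<psi> \<in> half_space" if "\<psi> \<in> {0<..<pi/2}" for t \<psi>
    using that by (intro e_rho_half_space) auto
  note df = d[unfolded twice_differentiable_with_def]
  have dd: "(f has_real_derivative f1 \<psi>) (at \<psi>)" "(f1 has_real_derivative f2 \<psi>) (at \<psi>)"
    "(g has_real_derivative g1 \<psi>) (at \<psi>)" "(g1 has_real_derivative g2 \<psi>) (at \<psi>)"
    "(h has_real_derivative h1 \<psi>) (at \<psi>)" "(h1 has_real_derivative h2 \<psi>) (at \<psi>)"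
    if "\<psi> \<in> {0<..<pi/2}" for \<psi>
    using that df by blast+
  let ?F = "frame \<theta> \<phi> ?f ?g ?h"
  have radial: "directional ?x v (1 *\<^sub>R ?x) = (- (1 / 1^2)) *\<^sub>R ?F"
    "directional 0 v (1 *\<^sub>R ?x) + hessian_form ?x v (1 *\<^sub>R ?x) = 2 *\<^sub>R ?F"
  proof -
    have 1: "((\<lambda>t. t *\<^sub>R ?x) has_vector_derivative ?x) (at t)" for t
      by (auto intro!: derivative_eq_intros)
    have 2: "((\<lambda>_::real. ?x) has_vector_derivative 0) (at 1)" by simp
    have 3: "v (t *\<^sub>R ?x) = (1 / t) *\<^sub>R ?F" if "t \<in> {0<..}" for t
      using pr \<phi> that unfolding has_profile_def spherical_eq_e_rho by auto
    have 4: "((\<lambda>t. (1 / t) *\<^sub>R ?F) has_vector_derivative (- (1 / t^2)) *\<^sub>R ?F) (at t)" if "t \<in> {0<..}" for t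
      using that by (auto intro!: derivative_eq_intros simp: power2_eq_square)
    have 5: "((\<lambda>t. (- (1 / t^2)) *\<^sub>R ?F) has_vector_derivative 2 *\<^sub>R ?F) (at 1)"
      by (auto intro!: derivative_eq_intros)
    have 6: "t *\<^sub>R ?x \<in> half_space" if "t \<in> {0<..}" for t
      using that mem[OF \<phi>] by (simp add: scaleR_half_space)
    have 7: "open {0::real<..}" "1 \<in> {0::real<..}" by auto
    note D = derivatives_along_curve[OF sm 7, where x = "\<lambda>t. t *\<^sub>R ?x" and x' = "\<lambda>_. ?x" and x'' = 0
         and y = "\<lambda>t. (1 / t) *\<^sub>R ?F" and y' = "\<lambda>t. (- (1 / t^2)) *\<^sub>R ?F" and y'' = "2 *\<^sub>R ?F",
         OF 6 1 2 3 4 5]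
    show "directional ?x v (1 *\<^sub>R ?x) = (- (1 / 1^2)) *\<^sub>R ?F" by (rule D(1))
    show "directional 0 v (1 *\<^sub>R ?x) + hessian_form ?x v (1 *\<^sub>R ?x) = 2 *\<^sub>R ?F" by (rule D(2))
  qed
  show rho: ?rho using radial(1) by (simp add: frame_minus)
  have hrho: "hessian_form ?x v ?x = frame \<theta> \<phi> (2 * ?f) (2 * ?g) (2 * ?h)"
    using radial(2) by (simp add: frame_scaleR directional_def)
  have merid: "directional (e_phi \<theta> \<phi>) v ?x = frame \<theta> \<phi> (f1 \<phi> - ?h) (g1 \<phi>) (?f + h1 \<phi>)"
    "directional (- e_rho \<theta> \<phi>) v ?x + hessian_form (e_phi \<theta> \<phi>) v ?x
      = frame \<theta> \<phi> (f2 \<phi> - h1 \<phi> - (?f + h1 \<phi>)) (g2 \<phi>) (f1 \<phi> - ?h + (f1 \<phi> + h2 \<phi>))"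
  proof -
    have 3: "v (e_rho \<theta> t) = frame \<theta> t (f t) (g t) (h t)" if "t \<in> {0<..<pi/2}" for t
      using that by (intro profile_on_sphere[OF pr]) auto
    have 4: "((\<lambda>t. frame \<theta> t (f t) (g t) (h t)) has_vector_derivative
        frame \<theta> t (f1 t - h t) (g1 t) (f t + h1 t)) (at t)" if "t \<in> {0<..<pi/2}" for t
      by (intro frame_derivative_phi dd that)
    have 5: "((\<lambda>t. frame \<theta> t (f1 t - h t) (g1 t) (f t + h1 t)) has_vector_derivative
      frame \<theta> \<phi> (f2 \<phi> - h1 \<phi> - (?f + h1 \<phi>)) (g2 \<phi>) (f1 \<phi> - ?h + (f1 \<phi> + h2 \<phi>))) (at \<phi>)"
      by (intro frame_derivative_phi DERIV_diff DERIV_add dd \<phi>)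
    note D = derivatives_along_curve[OF sm open_greaterThanLessThan \<phi>, where x = "e_rho \<theta>" and x' = "e_phi \<theta>" and x'' = "- e_rho \<theta> \<phi>"
         and y = "\<lambda>t. frame \<theta> t (f t) (g t) (h t)" and y' = "\<lambda>t. frame \<theta> t (f1 t - h t) (g1 t) (f t + h1 t)"
         and y'' = "frame \<theta> \<phi> (f2 \<phi> - h1 \<phi> - (?f + h1 \<phi>)) (g2 \<phi>) (f1 \<phi> - ?h + (f1 \<phi> + h2 \<phi>))",
         OF mem e_rho_derivative_phi e_phi_derivative_phi 3 4 5]
    show "directional (e_phi \<theta> \<phi>) v ?x = frame \<theta> \<phi> (f1 \<phi> - ?h) (g1 \<phi>) (?f + h1 \<phi>)" by (rule D(1))
    show "directional (- e_rho \<theta> \<phi>) v ?x + hessian_form (e_phi \<theta> \<phi>) v ?x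
      = frame \<theta> \<phi> (f2 \<phi> - h1 \<phi> - (?f + h1 \<phi>)) (g2 \<phi>) (f1 \<phi> - ?h + (f1 \<phi> + h2 \<phi>))" by (rule D(2))
  qed
  then show phi: ?phi by simp
  have hphi: "hessian_form (e_phi \<theta> \<phi>) v ?x
     = frame \<theta> \<phi> (f2 \<phi> - 2 * h1 \<phi> - 2 * ?f) (g2 \<phi> - ?g) (2 * f1 \<phi> - 2 * ?h + h2 \<phi>)"
  proof -
    have "hessian_form (e_phi \<theta> \<phi>) v ?x = frame \<theta> \<phi> (f2 \<phi> - h1 \<phi> - (?f + h1 \<phi>)) (g2 \<phi>) (f1 \<phi> - ?h + (f1 \<phi> + h2 \<phi>))
        + directional (e_rho \<theta> \<phi>) v ?x"
      using merid(2) by (simp add: directional_minus algebra_simps)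
    then show ?thesis by (simp add: rho frame_add frame_eq_iff)
  qed
  \<comment> \<open>The derivative, along the parallel, of the field with constant components \<open>a\<close>, \<open>b\<close>, \<open>c\<close>.\<close>
  define F where "F a b c \<theta> = frame \<theta> \<phi> (- b * ?s) (a * ?s + c * ?c) (- b * ?c)" for a b c \<theta>
  have dF: "((\<lambda>\<theta>. frame \<theta> \<phi> a b c) has_vector_derivative F a b c t) (at t)" for a b c t
    unfolding F_def by (rule frame_derivative_theta)
  have parallel: "directional (?s *\<^sub>R e_theta \<theta>) v ?x = F ?f ?g ?h \<theta>"
     "directional (F 0 ?s 0 \<theta>) v ?x + hessian_form (?s *\<^sub>R e_theta \<theta>) v ?x
        = F (- ?g * ?s) (?f * ?s + ?h * ?c) (- ?g * ?c) \<theta>"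
  proof -
    have 1: "((\<lambda>t. e_rho t \<phi>) has_vector_derivative ?s *\<^sub>R e_theta t) (at t)" for t
      using dF[of 1 0 0 t] by (simp add: F_def e_as_frame(2)[of t \<phi>] e_as_frame(1)[of _ \<phi>] frame_scaleR)
    have 2: "((\<lambda>t. ?s *\<^sub>R e_theta t) has_vector_derivative F 0 ?s 0 \<theta>) (at \<theta>)"
      using dF[of 0 ?s 0 \<theta>] by (simp add: e_as_frame(2)[of _ \<phi>] frame_scaleR)
    have 3: "v (e_rho t \<phi>) = frame t \<phi> ?f ?g ?h" for t
      using \<phi> by (intro profile_on_sphere[OF pr]) auto
    have 5: "(F ?f ?g ?h has_vector_derivative F (- ?g * ?s) (?f * ?s + ?h * ?c) (- ?g * ?c) \<theta>) (at \<theta>)"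
      using dF[of "- ?g * ?s" "?f * ?s + ?h * ?c" "- ?g * ?c" \<theta>] by (simp add: F_def[abs_def])
    note D = derivatives_along_curve[OF sm open_UNIV UNIV_I, where x = "\<lambda>t. e_rho t \<phi>" and x' = "\<lambda>t. ?s *\<^sub>R e_theta t" and x'' = "F 0 ?s 0 \<theta>"
         and y = "\<lambda>t. frame t \<phi> ?f ?g ?h" and y' = "F ?f ?g ?h"
         and y'' = "F (- ?g * ?s) (?f * ?s + ?h * ?c) (- ?g * ?c) \<theta>",
         OF mem[OF \<phi>] 1 2 3 dF 5]
    show "directional (?s *\<^sub>R e_theta \<theta>) v ?x = F ?f ?g ?h \<theta>" by (rule D(1))
    show "directional (F 0 ?s 0 \<theta>) v ?x + hessian_form (?s *\<^sub>R e_theta \<theta>) v ?x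
        = F (- ?g * ?s) (?f * ?s + ?h * ?c) (- ?g * ?c) \<theta>" by (rule D(2))
  qed
  have "?s *\<^sub>R directional (e_theta \<theta>) v ?x = F ?f ?g ?h \<theta>"
    using parallel(1) by (simp add: directional_scaleR)
  then have "(1 / ?s) *\<^sub>R (?s *\<^sub>R directional (e_theta \<theta>) v ?x) = (1 / ?s) *\<^sub>R F ?f ?g ?h \<theta>" by simp
  then show ?theta using s0 by (simp add: F_def)
  \<comment> \<open>The parallel is not a geodesic: its acceleration points to the axis and has radial and polar parts.\<close>
  have turn: "directional (F 0 ?s 0 \<theta>) v ?x
      = (- ?s\<^sup>2) *\<^sub>R directional (e_rho \<theta> \<phi>) v ?x + (- ?s * ?c) *\<^sub>R directional (e_phi \<theta> \<phi>) v ?x"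
    unfolding directional_scaleR[symmetric] directional_add[symmetric]
    by (simp add: F_def frame_def power2_eq_square)
  have htheta: "?s\<^sup>2 *\<^sub>R hessian_form (e_theta \<theta>) v ?x
     = frame \<theta> \<phi> (- (?f * ?s + ?h * ?c) * ?s - ?s\<^sup>2 * ?f + ?s * ?c * (f1 \<phi> - ?h))
        (- ?g * ?s\<^sup>2 - ?g * ?c\<^sup>2 - ?s\<^sup>2 * ?g + ?s * ?c * g1 \<phi>)
        (- (?f * ?s + ?h * ?c) * ?c - ?s\<^sup>2 * ?h + ?s * ?c * (?f + h1 \<phi>))"
  proof -
    have "?s\<^sup>2 *\<^sub>R hessian_form (e_theta \<theta>) v ?x
       = F (- ?g * ?s) (?f * ?s + ?h * ?c) (- ?g * ?c) \<theta> - directional (F 0 ?s 0 \<theta>) v ?x"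
      using parallel(2) by (simp only: hessian_form_scaleR add_diff_cancel_left' flip: parallel(2))
    also have "\<dots> = F (- ?g * ?s) (?f * ?s + ?h * ?c) (- ?g * ?c) \<theta>
       - ((- ?s\<^sup>2) *\<^sub>R frame \<theta> \<phi> (- ?f) (- ?g) (- ?h) + (- ?s * ?c) *\<^sub>R frame \<theta> \<phi> (f1 \<phi> - ?h) (g1 \<phi>) (?f + h1 \<phi>))"
      by (simp only: turn rho phi)
    finally show ?thesis
      unfolding F_def frame_scaleR frame_add frame_diff by (simp add: frame_eq_iff power2_eq_square algebra_simps)
  qed
  have pyth: "r = ?c * (?c * r) + ?s * (?s * r) \<longleftrightarrow> True" for r :: real
  proof -
    have "?c * (?c * r) + ?s * (?s * r) = (?c\<^sup>2 + ?s\<^sup>2) * r"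
      by (simp only: power2_eq_square distrib_right mult.assoc)
    then show ?thesis by (simp only: sin_cos_squared_add2 mult_1 simp_thms)
  qed
  show ?lap
    unfolding laplacian_frame[of _ _ \<theta> \<phi>] scaleR_add_right htheta hrho hphi frame_scaleR frame_add frame_eq_iff
    by (auto simp: power2_eq_square algebra_simps pyth)
qed

text \<open>The profiles are the components of the field along a meridian, which is a smooth curve through the
axis; this is why they, and the derivative of the radial one, stay continuous up to \<open>\<phi> = 0\<close>, where the
ordinary differential equations degenerate.\<close>
lemma profile_twice_differentiable:
  assumes sm: "smooth_on half_space v" and pr: "has_profile v f g h"
  obtains f1 f2 g1 g2 h1 h2 where "twice_differentiable_with f f1 f2"
    "twice_differentiable_with g g1 g2" "twice_differentiable_with h h1 h2"
    "continuous_on {0..<pi/2} f" "continuous_on {0..<pi/2} g" "continuous_on {0..<pi/2} h"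
    "continuous_on {0..<pi/2} f1"
proof -
  define V where "V = (\<lambda>\<phi>. v (e_rho 0 \<phi>))"
  define V1 where "V1 = (\<lambda>\<phi>. directional (e_phi 0 \<phi>) v (e_rho 0 \<phi>))"
  define V2 where "V2 = (\<lambda>\<phi>. directional (- e_rho 0 \<phi>) v (e_rho 0 \<phi>) + hessian_form (e_phi 0 \<phi>) v (e_rho 0 \<phi>))"
  have dV: "(V has_vector_derivative V1 \<phi>) (at \<phi>)" "(V1 has_vector_derivative V2 \<phi>) (at \<phi>)"
    if "\<phi> \<in> {0..<pi/2}" for \<phi>
  proof -
    have m: "e_rho 0 \<phi> \<in> half_space" using that by (intro e_rho_half_space) (auto intro: less_le_trans)
    show "(V has_vector_derivative V1 \<phi>) (at \<phi>)" unfolding V_def V1_def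
      by (intro curve_derivative e_rho_derivative_phi smooth_on_differentiable[OF sm m])
    show "(V1 has_vector_derivative V2 \<phi>) (at \<phi>)" unfolding V1_def V2_def
      by (intro curve_second_derivative[where x = "e_rho 0" and x' = "e_phi 0", OF sm m] e_rho_derivative_phi e_phi_derivative_phi)
  qed
  have inner: "((\<lambda>t. x t \<bullet> y t) has_real_derivative x t \<bullet> y' + x' \<bullet> y t) (at t)"
    if "(x has_vector_derivative x') (at t)" "(y has_vector_derivative y') (at t)" for x y :: "real \<Rightarrow> real^3" and x' y' t
    using bounded_bilinear.has_vector_derivative[OF bounded_bilinear_inner that]
    by (simp add: has_real_derivative_iff_has_vector_derivative)
  have cV: "((\<lambda>_. c) has_vector_derivative 0) (at t)" for c :: "real^3" and t :: real by simp
  note er = e_rho_derivative_phi and ep = e_phi_derivative_phi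
  define f0 where "f0 = (\<lambda>\<phi>. e_rho 0 \<phi> \<bullet> V \<phi>)"
  define f1 where "f1 = (\<lambda>\<phi>. e_rho 0 \<phi> \<bullet> V1 \<phi> + e_phi 0 \<phi> \<bullet> V \<phi>)"
  define g0 where "g0 = (\<lambda>\<phi>. e_theta 0 \<bullet> V \<phi>)"
  define g1 where "g1 = (\<lambda>\<phi>. e_theta 0 \<bullet> V1 \<phi>)"
  define h0 where "h0 = (\<lambda>\<phi>. e_phi 0 \<phi> \<bullet> V \<phi>)"
  define h1 where "h1 = (\<lambda>\<phi>. e_phi 0 \<phi> \<bullet> V1 \<phi> + (- e_rho 0 \<phi>) \<bullet> V \<phi>)"
  have comp: "f \<phi> = f0 \<phi>" "g \<phi> = g0 \<phi>" "h \<phi> = h0 \<phi>" if "\<phi> \<in> {0..<pi/2}" for \<phi>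
    using profile_on_sphere[OF pr, of \<phi> 0] that by (simp_all add: f0_def g0_def h0_def V_def inner_frame)
  have d0: "(f0 has_real_derivative f1 \<phi>) (at \<phi>)" "(g0 has_real_derivative g1 \<phi>) (at \<phi>)" "(h0 has_real_derivative h1 \<phi>) (at \<phi>)"
    if "\<phi> \<in> {0..<pi/2}" for \<phi>
    using inner[OF er dV(1)[OF that], of 0] inner[OF cV dV(1)[OF that], of "e_theta 0"] inner[OF ep dV(1)[OF that], of 0]
    by (simp_all add: f0_def f1_def g0_def g1_def h0_def h1_def)
  have "\<exists>D. (f1 has_real_derivative D) (at \<phi>)" "\<exists>D. (g1 has_real_derivative D) (at \<phi>)" "\<exists>D. (h1 has_real_derivative D) (at \<phi>)"
    if "\<phi> \<in> {0..<pi/2}" for \<phi>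
    using DERIV_add[OF inner[OF er dV(2)[OF that], of 0] inner[OF ep dV(1)[OF that], of 0]]
      inner[OF cV dV(2)[OF that], of "e_theta 0"]
      DERIV_diff[OF inner[OF ep dV(2)[OF that], of 0] inner[OF er dV(1)[OF that], of 0]]
    unfolding f1_def g1_def h1_def by auto
  then obtain f2 g2 h2 where d1: "\<And>\<phi>. \<phi> \<in> {0..<pi/2} \<Longrightarrow> (f1 has_real_derivative f2 \<phi>) (at \<phi>)"
    "\<And>\<phi>. \<phi> \<in> {0..<pi/2} \<Longrightarrow> (g1 has_real_derivative g2 \<phi>) (at \<phi>)"
    "\<And>\<phi>. \<phi> \<in> {0..<pi/2} \<Longrightarrow> (h1 has_real_derivative h2 \<phi>) (at \<phi>)" by metis
  have tr: "(k has_real_derivative D) (at \<phi>)"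
    if "(k0 has_real_derivative D) (at \<phi>)" "\<And>\<phi>. \<phi> \<in> {0..<pi/2} \<Longrightarrow> k \<phi> = k0 \<phi>" "\<phi> \<in> {0<..<pi/2}" for k k0 D \<phi>
    using that(1) open_greaterThanLessThan that(3) by (rule has_field_derivative_transform_within_open) (simp add: that(2))
  have cont: "continuous_on {0..<pi/2} k"
    if "\<And>\<phi>. \<phi> \<in> {0..<pi/2} \<Longrightarrow> (k0 has_real_derivative D \<phi>) (at \<phi>)" "\<And>\<phi>. \<phi> \<in> {0..<pi/2} \<Longrightarrow> k \<phi> = k0 \<phi>" for k k0 D
  proof -
    have "continuous_on {0..<pi/2} k0"
      using that(1) by (intro continuous_at_imp_continuous_on ballI) (rule DERIV_isCont, blast)
    then show ?thesis by (rule continuous_on_eq) (simp only: that(2))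
  qed
  show ?thesis
  proof (rule that)
    show "twice_differentiable_with f f1 f2" "twice_differentiable_with g g1 g2" "twice_differentiable_with h h1 h2"
      unfolding twice_differentiable_with_def using tr[OF d0(1) comp(1)] tr[OF d0(2) comp(2)] tr[OF d0(3) comp(3)] d1
      by auto
    show "continuous_on {0..<pi/2} f" "continuous_on {0..<pi/2} g" "continuous_on {0..<pi/2} h" "continuous_on {0..<pi/2} f1"
      using cont[OF d0(1) comp(1)] cont[OF d0(2) comp(2)] cont[OF d0(3) comp(3)] cont[OF d1(1) refl] by blast+
  qed
qed

section \<open>The reduced system\<close>

lemma pressure_derivatives:
  fixes p :: "real^3 \<Rightarrow> real"
  assumes sm: "smooth_on half_space p"
    and hom: "\<forall>c>0. \<forall>x\<in>half_space. p x = c\<^sup>2 * p (c *\<^sub>R x)"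
    and \<phi>: "\<phi> \<in> {0<..<pi/2}"
  shows "directional (e_rho \<theta> \<phi>) p (e_rho \<theta> \<phi>) = - 2 * p (e_rho \<theta> \<phi>)"
    and "((\<lambda>t. p (e_rho \<theta> t)) has_real_derivative directional (e_phi \<theta> \<phi>) p (e_rho \<theta> \<phi>)) (at \<phi>)"
    and "((\<lambda>t. p (e_rho t \<phi>)) has_real_derivative sin \<phi> * directional (e_theta \<theta>) p (e_rho \<theta> \<phi>)) (at \<theta>)"
proof -
  let ?x = "e_rho \<theta> \<phi>"
  have mem: "?x \<in> half_space" using \<phi> by (intro e_rho_half_space) auto
  note diff = smooth_on_differentiable[OF sm mem]
  show "((\<lambda>t. p (e_rho \<theta> t)) has_real_derivative directional (e_phi \<theta> \<phi>) p ?x) (at \<phi>)"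
    unfolding has_real_derivative_iff_has_vector_derivative by (intro curve_derivative diff e_rho_derivative_phi)
  have "((\<lambda>t. e_rho t \<phi>) has_vector_derivative sin \<phi> *\<^sub>R e_theta \<theta>) (at \<theta>)"
    using frame_derivative_theta[of \<phi> 1 0 0 \<theta>] by (simp add: frame_def)
  from curve_derivative[OF diff this]
  show "((\<lambda>t. p (e_rho t \<phi>)) has_real_derivative sin \<phi> * directional (e_theta \<theta>) p ?x) (at \<theta>)"
    by (simp add: has_real_derivative_iff_has_vector_derivative directional_scaleR)
  have 1: "((\<lambda>t. t *\<^sub>R ?x) has_vector_derivative ?x) (at 1)"
    by (auto intro!: derivative_eq_intros)
  have "p differentiable at (1 *\<^sub>R ?x)" using diff by simp
  from curve_derivative[of p "\<lambda>t. t *\<^sub>R ?x", OF this 1]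
  have 2: "((\<lambda>t. p (t *\<^sub>R ?x)) has_real_derivative directional ?x p ?x) (at 1)"
    by (simp add: has_real_derivative_iff_has_vector_derivative)
  have 3: "((\<lambda>t. p (t *\<^sub>R ?x)) has_real_derivative - 2 * p ?x) (at 1)"
  proof (rule has_field_derivative_transform_within_open[OF _ open_greaterThan])
    show "((\<lambda>t. p ?x / t^2) has_real_derivative - 2 * p ?x) (at 1)"
      by (auto intro!: derivative_eq_intros)
    show "(1::real) \<in> {0<..}" by simp
    show "p ?x / t\<^sup>2 = p (t *\<^sub>R ?x)" if "t \<in> {0<..}" for t
      using hom[rule_format, OF _ mem, of t] that by (simp add: field_simps)
  qed
  show "directional ?x p ?x = - 2 * p ?x" by (rule DERIV_unique[OF 2 3])
qed

text \<open>The swirl equation contains no pressure: \<open>\<partial>p/\<partial>\<theta>\<close> is determined by the other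
terms of the momentum equation and therefore independent of \<open>\<theta>\<close>, while \<open>p\<close> is periodic in \<open>\<theta>\<close>, so that
it vanishes.\<close>
lemma mhd_profile_equations:
  assumes sm: "smooth_on half_space u" "smooth_on half_space B" "smooth_on half_space p"
    and hom: "\<forall>c>0. \<forall>x\<in>half_space. p x = c\<^sup>2 * p (c *\<^sub>R x)"
    and mhd: "stationary_mhd u B p"
    and pr: "has_profile u f g h" "has_profile B (\<lambda>_. 0) b (\<lambda>_. 0)"
    and d: "twice_differentiable_with f f1 f2" "twice_differentiable_with g g1 g2"
      "twice_differentiable_with h h1 h2" "twice_differentiable_with b b1 b2"
    and \<phi>: "\<phi> \<in> {0<..<pi/2}"
  defines "s \<equiv> sin \<phi>" and "c \<equiv> cos \<phi>"
  shows "h1 \<phi> = - f \<phi> - h \<phi> * c / s" (is ?div)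
    and "h \<phi> * b1 \<phi> = 2 * f \<phi> * b \<phi> + h \<phi> * b \<phi> * c / s" (is ?ind)
    and "s\<^sup>2 * g2 \<phi> + s * c * g1 \<phi> - g \<phi> = s\<^sup>2 * h \<phi> * g1 \<phi> + s * c * h \<phi> * g \<phi>" (is ?swirl)
    and "f2 \<phi> + f1 \<phi> * c / s = h \<phi> * f1 \<phi> - (f \<phi>)\<^sup>2 - (g \<phi>)\<^sup>2 - (h \<phi>)\<^sup>2 + (b \<phi>)\<^sup>2 - 2 * p (e_rho 0 \<phi>)" (is ?radial)
    and "s\<^sup>2 * directional (e_phi 0 \<phi>) p (e_rho 0 \<phi>) = s\<^sup>2 * h2 \<phi> + s * c * h1 \<phi> + 2 * s\<^sup>2 * f1 \<phi> - h \<phi>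
       - s\<^sup>2 * h \<phi> * h1 \<phi> + s * c * (g \<phi>)\<^sup>2 - s * c * (b \<phi>)\<^sup>2" (is ?polar)
proof -
  have s0: "s > 0" unfolding s_def using \<phi> by (intro sin_gt_zero) auto
  have d0: "twice_differentiable_with (\<lambda>_. 0) (\<lambda>_. 0) (\<lambda>_. 0)"
    by (simp add: twice_differentiable_with_def)
  note Du = profile_derivatives[OF sm(1) pr(1) \<phi> d(1,2,3), folded s_def c_def]
  note DB = profile_derivatives[OF sm(2) pr(2) \<phi> d0 d(4) d0, folded s_def c_def]
  have val: "u (e_rho \<theta> \<phi>) = frame \<theta> \<phi> (f \<phi>) (g \<phi>) (h \<phi>)" "B (e_rho \<theta> \<phi>) = frame \<theta> \<phi> 0 (b \<phi>) 0" for \<theta>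
    using profile_on_sphere[OF pr(1)] profile_on_sphere[OF pr(2)] \<phi> by simp_all
  have eqs: "- laplacian u (e_rho \<theta> \<phi>) + convective u u (e_rho \<theta> \<phi>) - convective B B (e_rho \<theta> \<phi>) + grad p (e_rho \<theta> \<phi>) = 0"
      "convective u B (e_rho \<theta> \<phi>) = convective B u (e_rho \<theta> \<phi>)" "divergence u (e_rho \<theta> \<phi>) = 0" for \<theta>
    using mhd e_rho_half_space[of \<phi> \<theta>] \<phi> unfolding stationary_mhd_def by auto
  have dirframe: "directional (frame \<theta> \<phi> x y z) w q = x *\<^sub>R directional (e_rho \<theta> \<phi>) w q
      + y *\<^sub>R directional (e_theta \<theta>) w q + z *\<^sub>R directional (e_phi \<theta> \<phi>) w q"
    for \<theta> x y z q and w :: "real^3 \<Rightarrow> real^3"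
    by (simp add: frame_def directional_add directional_scaleR)
  have gradp: "grad p q = frame \<theta> \<phi> (directional (e_rho \<theta> \<phi>) p q) (directional (e_theta \<theta>) p q) (directional (e_phi \<theta> \<phi>) p q)" for q \<theta>
    using frame_expansion[of "grad p q" \<theta> \<phi>] by (simp add: inner_grad)
  show div: ?div
    using eqs(3)[of 0] s0 unfolding divergence_frame[of _ _ 0 \<phi>] Du frame_scaleR inner_frame by (simp add: field_simps)
  show ?ind
    using eqs(2)[of 0] s0
    unfolding convective_eq_directional val dirframe Du DB frame_scaleR frame_add frame_eq_iff
    by (simp add: field_simps)
  have mom: "s\<^sup>2 *\<^sub>R frame \<theta> \<phi> (directional (e_rho \<theta> \<phi>) p (e_rho \<theta> \<phi>))
        (directional (e_theta \<theta>) p (e_rho \<theta> \<phi>)) (directional (e_phi \<theta> \<phi>) p (e_rho \<theta> \<phi>)) = s\<^sup>2 *\<^sub>R laplacian u (e_rho \<theta> \<phi>)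
     - s\<^sup>2 *\<^sub>R convective u u (e_rho \<theta> \<phi>) + s\<^sup>2 *\<^sub>R convective B B (e_rho \<theta> \<phi>)" for \<theta>
  proof -
    have "grad p (e_rho \<theta> \<phi>) = laplacian u (e_rho \<theta> \<phi>) - convective u u (e_rho \<theta> \<phi>) + convective B B (e_rho \<theta> \<phi>)"
      using eqs(1)[of \<theta>] by (simp add: algebra_simps eq_neg_iff_add_eq_0)
    then show ?thesis unfolding gradp[symmetric] by (simp only: scaleR_add_right scaleR_diff_right)
  qed
  note comps = mom[unfolded convective_eq_directional val dirframe Du DB frame_scaleR frame_add frame_diff frame_eq_iff]
  note press = pressure_derivatives[OF sm(3) hom \<phi>]
  \<comment> \<open>The derivative of the pressure along the parallel, a function of \<open>\<phi>\<close> only.\<close>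
  define K where "K = (s\<^sup>2 * g2 \<phi> + s * c * g1 \<phi> - g \<phi> - s\<^sup>2 * h \<phi> * g1 \<phi> - s * c * h \<phi> * g \<phi>) / s"
  have "s * directional (e_theta \<theta>) p (e_rho \<theta> \<phi>) = K" for \<theta>
  proof -
    have "s * (s\<^sup>2 * directional (e_theta \<theta>) p (e_rho \<theta> \<phi>))
        = s * (s\<^sup>2 * g2 \<phi> + s * c * g1 \<phi> - g \<phi> - s\<^sup>2 * h \<phi> * g1 \<phi> - s * c * h \<phi> * g \<phi>)"
      using comps[of \<theta>] s0 by (simp add: field_simps power2_eq_square)
    then have "s\<^sup>2 * directional (e_theta \<theta>) p (e_rho \<theta> \<phi>) = s * K" using s0 by (simp add: K_def)
    then show ?thesis using s0 by (simp add: power2_eq_square)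
  qed
  then have "((\<lambda>t. p (e_rho t \<phi>)) has_real_derivative K) (at \<theta>)" for \<theta>
    using press(3)[of \<theta>] by (simp add: s_def)
  then obtain z :: real where "p (e_rho (2 * pi) \<phi>) - p (e_rho 0 \<phi>) = (2 * pi - 0) * K"
    using MVT2[of 0 "2 * pi" "\<lambda>t. p (e_rho t \<phi>)" "\<lambda>_. K"] by auto
  moreover have "e_rho (2 * pi) \<phi> = e_rho 0 \<phi>" by (simp add: e_rho_def)
  ultimately have "K = 0" by simp
  then show ?swirl using s0 by (simp add: K_def)
  have "s\<^sup>2 * (- 2 * p (e_rho 0 \<phi>)) = s\<^sup>2 * f2 \<phi> + s * c * f1 \<phi> - 2 * s\<^sup>2 * f \<phi> - 2 * s * c * h \<phi> - 2 * s\<^sup>2 * h1 \<phi>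
     + s\<^sup>2 * (f \<phi>)\<^sup>2 + s\<^sup>2 * (g \<phi>)\<^sup>2 - s\<^sup>2 * h \<phi> * (f1 \<phi> - h \<phi>) - s\<^sup>2 * (b \<phi>)\<^sup>2"
    using comps[of 0] s0 by (simp add: press(1) field_simps power2_eq_square)
  then have "s * (s * (f2 \<phi> + f1 \<phi> * c / s)) = s * (s * (h \<phi> * f1 \<phi> - (f \<phi>)\<^sup>2 - (g \<phi>)\<^sup>2 - (h \<phi>)\<^sup>2
      + (b \<phi>)\<^sup>2 - 2 * p (e_rho 0 \<phi>)))"
    using s0 by (simp add: div field_simps power2_eq_square)
  then show ?radial using s0 by simp
  have "s * (s\<^sup>2 * directional (e_phi 0 \<phi>) p (e_rho 0 \<phi>)) = s * (s\<^sup>2 * h2 \<phi> + s * c * h1 \<phi> + 2 * s\<^sup>2 * f1 \<phi> - h \<phi>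
       - s\<^sup>2 * h \<phi> * h1 \<phi> + s * c * (g \<phi>)\<^sup>2 - s * c * (b \<phi>)\<^sup>2)"
    using comps[of 0] s0 by (simp add: field_simps power2_eq_square)
  then show ?polar using s0 by simp
qed

section \<open>The ordinary differential equations\<close>

text \<open>Uniqueness for \<open>y' = k y\<close> with bounded \<open>k\<close>, in the form of two-sided exponential bounds: \<open>y\<^sup>2 exp (2 C x)\<close>
increases and \<open>y\<^sup>2 exp (- 2 C x)\<close> decreases.\<close>
lemma linear_ode_growth:
  fixes y k :: "real \<Rightarrow> real"
  assumes der: "\<And>x. x \<in> {a<..<b} \<Longrightarrow> (y has_real_derivative k x * y x) (at x)"
    and bd: "\<And>x. x \<in> {a<..<b} \<Longrightarrow> \<bar>k x\<bar> \<le> C"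
    and x: "a < x" "x \<le> t" "t < b"
  shows "(y x)\<^sup>2 \<le> (y t)\<^sup>2 * exp (2 * C * (t - x))" and "(y t)\<^sup>2 \<le> (y x)\<^sup>2 * exp (2 * C * (t - x))"
proof -
  have d: "((\<lambda>x. (y x)\<^sup>2 * exp (2 * r * x)) has_real_derivative 2 * (k z + r) * ((y z)\<^sup>2 * exp (2 * r * z))) (at z)"
    if "x \<le> z" "z \<le> t" for z r
  proof -
    have "z \<in> {a<..<b}" using that x by auto
    note dz = der[OF this]
    show ?thesis
      by (rule derivative_eq_intros dz refl)+ (simp add: power2_eq_square algebra_simps)
  qed
  have k: "0 \<le> k z + C" "k z + - C \<le> 0" if "x \<le> z" "z \<le> t" for z
    using bd[of z] that x by (auto simp: abs_le_iff)
  have "(y x)\<^sup>2 * exp (2 * C * x) \<le> (y t)\<^sup>2 * exp (2 * C * t)"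
  proof (rule DERIV_nonneg_imp_nondecreasing[OF x(2)])
    fix z assume z: "x \<le> z" "z \<le> t"
    show "\<exists>D. ((\<lambda>x. (y x)\<^sup>2 * exp (2 * C * x)) has_real_derivative D) (at z) \<and> 0 \<le> D"
      using d[OF z, of C] k(1)[OF z] by (intro exI conjI) (assumption, simp)
  qed
  then show "(y x)\<^sup>2 \<le> (y t)\<^sup>2 * exp (2 * C * (t - x))"
    by (simp add: right_diff_distrib exp_diff field_simps)
  have "(y t)\<^sup>2 * exp (2 * (- C) * t) \<le> (y x)\<^sup>2 * exp (2 * (- C) * x)"
  proof (rule DERIV_nonpos_imp_nonincreasing[OF x(2)])
    fix z assume z: "x \<le> z" "z \<le> t"
    show "\<exists>D. ((\<lambda>x. (y x)\<^sup>2 * exp (2 * (- C) * x)) has_real_derivative D) (at z) \<and> D \<le> 0"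
      using d[OF z, of "- C"] k(2)[OF z]
      by (intro exI conjI) (assumption, simp add: mult_nonpos_nonneg)
  qed
  then show "(y t)\<^sup>2 \<le> (y x)\<^sup>2 * exp (2 * C * (t - x))"
    by (simp add: right_diff_distrib exp_diff exp_minus field_simps)
qed

lemma linear_ode_zero_interior:
  fixes y k :: "real \<Rightarrow> real"
  assumes "\<And>x. x \<in> {a<..<b} \<Longrightarrow> (y has_real_derivative k x * y x) (at x)"
    and "\<And>x. x \<in> {a<..<b} \<Longrightarrow> \<bar>k x\<bar> \<le> C"
    and "z \<in> {a<..<b}" "y z = 0" "x \<in> {a<..<b}"
  shows "y x = 0"
proof (cases "x \<le> z")
  case True
  have "(y x)\<^sup>2 \<le> (y z)\<^sup>2 * exp (2 * C * (z - x))"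
    using assms(3,5) True by (intro linear_ode_growth(1)[OF assms(1,2)]) auto
  with assms(4) show ?thesis by simp
next
  case False
  have "(y x)\<^sup>2 \<le> (y z)\<^sup>2 * exp (2 * C * (x - z))"
    using assms(3,5) False by (intro linear_ode_growth(2)[OF assms(1,2)]) auto
  with assms(4) show ?thesis by simp
qed

lemma linear_ode_zero_at_end:
  fixes y k :: "real \<Rightarrow> real"
  assumes "\<And>x. x \<in> {a<..<b} \<Longrightarrow> (y has_real_derivative k x * y x) (at x)"
    and "\<And>x. x \<in> {a<..<b} \<Longrightarrow> \<bar>k x\<bar> \<le> C"
    and lim: "(y \<longlongrightarrow> 0) (at_left b)" and x: "x \<in> {a<..<b}"
  shows "y x = 0"
proof -
  have "((\<lambda>t. (y t)\<^sup>2 * exp (2 * C * (t - x))) \<longlongrightarrow> 0\<^sup>2 * exp (2 * C * (b - x))) (at_left b)"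
    by (intro tendsto_intros lim)
  moreover have "\<forall>\<^sub>F t in at_left b. (y x)\<^sup>2 \<le> (y t)\<^sup>2 * exp (2 * C * (t - x))"
  proof (rule eventually_mono)
    show "\<forall>\<^sub>F t in at_left b. t \<in> {x<..<b}" using x by (intro eventually_at_left_real) auto
    show "(y x)\<^sup>2 \<le> (y t)\<^sup>2 * exp (2 * C * (t - x))" if "t \<in> {x<..<b}" for t
      using x that by (intro linear_ode_growth(1)[OF assms(1,2)]) auto
  qed
  ultimately have "(y x)\<^sup>2 \<le> 0\<^sup>2 * exp (2 * C * (b - x))"
    by (rule tendsto_lowerbound) simp
  then show ?thesis by simp
qed

lemma locally_zero_derivative:
  assumes "(f has_real_derivative D) (at x)" "open T" "x \<in> T" "\<And>y. y \<in> T \<Longrightarrow> f y = 0"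
  shows "D = 0"
proof -
  have "((\<lambda>_. 0) has_real_derivative D) (at x)"
    using assms(1-3) by (rule has_field_derivative_transform_within_open) (rule assms(4))
  then show ?thesis by (rule DERIV_unique) simp
qed

lemma continuous_on_bounded_interior:
  fixes k :: "real \<Rightarrow> real"
  assumes "continuous_on {a..b} k"
  obtains C where "\<And>x. x \<in> {a<..<b} \<Longrightarrow> \<bar>k x\<bar> \<le> C"
proof -
  have "bounded (k ` {a..b})"
    by (intro compact_imp_bounded compact_continuous_image assms compact_Icc)
  then obtain C where "\<forall>y\<in>k ` {a..b}. norm y \<le> C" unfolding bounded_iff by blast
  then show ?thesis by (intro that[of C]) auto
qed

lemma sin_pos_in_quadrant: "\<phi> \<in> {0<..<pi/2} \<Longrightarrow> sin \<phi> > 0"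
  by (intro sin_gt_zero) auto

text \<open>Incompressibility reduces the viscous part of the polar momentum equation to the first derivative of
the radial profile.\<close>
lemma polar_pressure_gradient:
  assumes d: "twice_differentiable_with f f1 f2" "twice_differentiable_with h h1 h2"
    and div: "\<And>\<phi>. \<phi> \<in> {0<..<pi/2} \<Longrightarrow> h1 \<phi> = - f \<phi> - h \<phi> * cos \<phi> / sin \<phi>"
    and polar: "(sin \<phi>)\<^sup>2 * q = (sin \<phi>)\<^sup>2 * h2 \<phi> + sin \<phi> * cos \<phi> * h1 \<phi> + 2 * (sin \<phi>)\<^sup>2 * f1 \<phi> - h \<phi>
       - (sin \<phi>)\<^sup>2 * h \<phi> * h1 \<phi> + sin \<phi> * cos \<phi> * (g \<phi>)\<^sup>2 - sin \<phi> * cos \<phi> * (b \<phi>)\<^sup>2"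
    and \<phi>: "\<phi> \<in> {0<..<pi/2}"
  shows "q = f1 \<phi> - h \<phi> * h1 \<phi> + ((g \<phi>)\<^sup>2 - (b \<phi>)\<^sup>2) * cos \<phi> / sin \<phi>"
proof -
  have s: "sin \<phi> > 0" by (rule sin_pos_in_quadrant[OF \<phi>])
  have df: "(f has_real_derivative f1 \<phi>) (at \<phi>)" "(h has_real_derivative h1 \<phi>) (at \<phi>)" "(h1 has_real_derivative h2 \<phi>) (at \<phi>)"
    using d \<phi> by (auto simp: twice_differentiable_with_def)
  \<comment> \<open>Differentiating the divergence equation, cleared of its denominator, gives \<open>h2\<close>.\<close>
  have "((\<lambda>t. h1 t * sin t + f t * sin t + h t * cos t) has_real_derivative
     h2 \<phi> * sin \<phi> + h1 \<phi> * cos \<phi> + f1 \<phi> * sin \<phi> + f \<phi> * cos \<phi> + h1 \<phi> * cos \<phi> - h \<phi> * sin \<phi>) (at \<phi>)"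
    by (rule derivative_eq_intros df refl)+ (simp add: algebra_simps)
  from locally_zero_derivative[OF this open_greaterThanLessThan \<phi>]
  have h2: "h2 \<phi> * sin \<phi> = - (h1 \<phi> * cos \<phi> + f1 \<phi> * sin \<phi> + f \<phi> * cos \<phi> + h1 \<phi> * cos \<phi> - h \<phi> * sin \<phi>)"
    using div sin_pos_in_quadrant by (fastforce simp: field_simps)
  have f\<phi>: "f \<phi> * sin \<phi> = - h1 \<phi> * sin \<phi> - h \<phi> * cos \<phi>"
    using div[OF \<phi>] s by (simp add: field_simps)
  have "(sin \<phi>)\<^sup>2 * h2 \<phi> + sin \<phi> * cos \<phi> * h1 \<phi> + (sin \<phi>)\<^sup>2 * f1 \<phi> - h \<phi> = 0"
    using h2 f\<phi> sin_cos_squared_add[of \<phi>] by algebra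
  then have "(sin \<phi>)\<^sup>2 * q
     = (sin \<phi>)\<^sup>2 * (f1 \<phi> - h \<phi> * h1 \<phi>) + sin \<phi> * cos \<phi> * ((g \<phi>)\<^sup>2 - (b \<phi>)\<^sup>2)"
    using polar by (simp add: algebra_simps)
  also have "\<dots> = (sin \<phi>)\<^sup>2 * (f1 \<phi> - h \<phi> * h1 \<phi> + ((g \<phi>)\<^sup>2 - (b \<phi>)\<^sup>2) * cos \<phi> / sin \<phi>)"
    using s by (simp add: field_simps power2_eq_square)
  finally show ?thesis using s by simp
qed

text \<open>The function \<open>G = g' + g cot \<phi>\<close>, which is \<open>(g sin \<phi>)' / sin \<phi>\<close>, satisfies \<open>G' = h G\<close>, so it vanishes
identically as soon as it vanishes once.  Under the no-slip condition \<open>g sin \<phi>\<close> is zero at the axis and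
at the equator, and Rolle's theorem gives a zero of \<open>G\<close>; under the slip condition \<open>G\<close> tends to zero at the
equator.  In both cases \<open>g sin \<phi>\<close> is constant, and it is zero on the axis.\<close>
lemma swirl_vanishes:
  assumes cont: "continuous_on {0..pi/2} g" "continuous_on {0..pi/2} h"
    and d: "twice_differentiable_with g g1 g2"
    and swirl: "\<And>\<phi>. \<phi> \<in> {0<..<pi/2} \<Longrightarrow>
      (sin \<phi>)\<^sup>2 * g2 \<phi> + sin \<phi> * cos \<phi> * g1 \<phi> - g \<phi> = (sin \<phi>)\<^sup>2 * h \<phi> * g1 \<phi> + sin \<phi> * cos \<phi> * h \<phi> * g \<phi>"
    and bc: "g (pi/2) = 0 \<or> (g1 \<longlongrightarrow> 0) (at_left (pi/2))"
    and x: "x \<in> {0<..<pi/2}"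
  shows "g x = 0"
proof -
  \<comment> \<open>The derivative of \<open>g sin \<phi>\<close> divided by \<open>sin \<phi>\<close>.\<close>
  define G where "G = (\<lambda>\<phi>. g1 \<phi> + g \<phi> * cos \<phi> / sin \<phi>)"
  have dg: "(g has_real_derivative g1 \<phi>) (at \<phi>)" "(g1 has_real_derivative g2 \<phi>) (at \<phi>)" if "\<phi> \<in> {0<..<pi/2}" for \<phi>
    using d that unfolding twice_differentiable_with_def by auto
  have dG: "(G has_real_derivative h \<phi> * G \<phi>) (at \<phi>)" if \<phi>: "\<phi> \<in> {0<..<pi/2}" for \<phi>
  proof -
    have s: "sin \<phi> > 0" by (rule sin_pos_in_quadrant[OF \<phi>])
    have p: "cos \<phi> * cos \<phi> = 1 - sin \<phi> * sin \<phi>" using sin_cos_squared_add[of \<phi>] by (simp add: power2_eq_square)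
    have "(G has_real_derivative g2 \<phi> + ((g1 \<phi> * cos \<phi> - g \<phi> * sin \<phi>) * sin \<phi> - g \<phi> * cos \<phi> * cos \<phi>) / (sin \<phi>)\<^sup>2) (at \<phi>)"
      unfolding G_def using s
      by (auto intro!: derivative_eq_intros dg \<phi> simp: power2_eq_square algebra_simps)
    moreover have "g2 \<phi> + ((g1 \<phi> * cos \<phi> - g \<phi> * sin \<phi>) * sin \<phi> - g \<phi> * cos \<phi> * cos \<phi>) / (sin \<phi>)\<^sup>2 = h \<phi> * G \<phi>"
    proof -
      have "(sin \<phi>)\<^sup>2 * (g2 \<phi> + ((g1 \<phi> * cos \<phi> - g \<phi> * sin \<phi>) * sin \<phi> - g \<phi> * cos \<phi> * cos \<phi>) / (sin \<phi>)\<^sup>2)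
        = (sin \<phi>)\<^sup>2 * g2 \<phi> + ((g1 \<phi> * cos \<phi> - g \<phi> * sin \<phi>) * sin \<phi> - g \<phi> * (1 - sin \<phi> * sin \<phi>))"
        using s by (simp add: distrib_left flip: p)
      also have "\<dots> = (sin \<phi>)\<^sup>2 * (h \<phi> * G \<phi>)"
        using swirl[OF \<phi>] s by (simp add: G_def field_simps power2_eq_square)
      finally show ?thesis using s by simp
    qed
    ultimately show ?thesis by simp
  qed
  obtain C where C: "\<And>\<phi>. \<phi> \<in> {0<..<pi/2} \<Longrightarrow> \<bar>h \<phi>\<bar> \<le> C"
    by (rule continuous_on_bounded_interior[OF cont(2)]) blast
  define \<Gamma> where "\<Gamma> = (\<lambda>\<phi>. g \<phi> * sin \<phi>)"
  have c\<Gamma>: "continuous_on {0..pi/2} \<Gamma>" unfolding \<Gamma>_def by (intro continuous_intros cont)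
  have d\<Gamma>: "(\<Gamma> has_real_derivative G \<phi> * sin \<phi>) (at \<phi>)" if "\<phi> \<in> {0<..<pi/2}" for \<phi>
    unfolding \<Gamma>_def G_def using sin_pos_in_quadrant[OF that]
    by (auto intro!: derivative_eq_intros dg that simp: field_simps)
  have G0: "G \<phi> = 0" if \<phi>: "\<phi> \<in> {0<..<pi/2}" for \<phi>
    using bc
  proof
    assume "g (pi/2) = 0"
    then have "\<Gamma> 0 = \<Gamma> (pi/2)" by (simp add: \<Gamma>_def)
    then obtain z where z: "0 < z" "z < pi/2" "(\<Gamma> has_real_derivative 0) (at z)"
      using Rolle[of 0 "pi/2" \<Gamma>] c\<Gamma> d\<Gamma> by (auto simp: real_differentiable_def)
    then have zI: "z \<in> {0<..<pi/2}" by simp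
    have "G z * sin z = 0" using DERIV_unique[OF d\<Gamma>[OF zI] z(3)] .
    then have "G z = 0" using sin_pos_in_quadrant[OF zI] by simp
    from linear_ode_zero_interior[OF dG C zI this \<phi>] show ?thesis .
  next
    assume lim: "(g1 \<longlongrightarrow> 0) (at_left (pi/2))"
    have "(g \<longlongrightarrow> g (pi/2)) (at_left (pi/2))"
      using cont(1) by (auto simp: continuous_on_Icc_at_leftD)
    then have "(G \<longlongrightarrow> 0 + g (pi/2) * cos (pi/2) / sin (pi/2)) (at_left (pi/2))"
      unfolding G_def by (intro tendsto_intros lim) auto
    then have "(G \<longlongrightarrow> 0) (at_left (pi/2))" by simp
    from linear_ode_zero_at_end[OF dG C this \<phi>] show ?thesis .
  qed
  have "\<Gamma> x = \<Gamma> 0"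
  proof (rule DERIV_isconst_end[where f = \<Gamma> and a = 0 and b = x])
    show "0 < x" using x by simp
    show "continuous_on {0..x} \<Gamma>" using x by (intro continuous_on_subset[OF c\<Gamma>]) auto
    show "(\<Gamma> has_real_derivative 0) (at \<phi>)" if "0 < \<phi>" "\<phi> < x" for \<phi>
      using d\<Gamma>[of \<phi>] G0[of \<phi>] that x by simp
  qed
  then show ?thesis using sin_pos_in_quadrant[OF x] by (simp add: \<Gamma>_def)
qed

text \<open>By the induction and divergence equations \<open>h\<^sup>2 b sin \<phi>\<close> is constant, hence zero: where the field \<open>b\<close> is
present there is no meridional flow.  There the radial momentum equation reads \<open>b\<^sup>2 = 2 P\<close> and the polar
one \<open>P' = - b\<^sup>2 cot \<phi>\<close>, which together say \<open>(b\<^sup>2 sin\<^sup>2 \<phi>)' = 0\<close>.  At the zeros of \<open>b\<close> this derivative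
vanishes trivially.  So \<open>b sin \<phi>\<close> has constant square and is zero on the axis.\<close>
lemma magnetic_profile_vanishes:
  assumes cont: "continuous_on {0..<pi/2} h" "continuous_on {0..<pi/2} b"
    and d: "twice_differentiable_with f f1 f2" "twice_differentiable_with h h1 h2" "twice_differentiable_with b b1 b2"
    and dP: "\<And>\<phi>. \<phi> \<in> {0<..<pi/2} \<Longrightarrow>
      (P has_real_derivative f1 \<phi> - h \<phi> * h1 \<phi> - (b \<phi>)\<^sup>2 * cos \<phi> / sin \<phi>) (at \<phi>)"
    and div: "\<And>\<phi>. \<phi> \<in> {0<..<pi/2} \<Longrightarrow> h1 \<phi> = - f \<phi> - h \<phi> * cos \<phi> / sin \<phi>"
    and ind: "\<And>\<phi>. \<phi> \<in> {0<..<pi/2} \<Longrightarrow> h \<phi> * b1 \<phi> = 2 * f \<phi> * b \<phi> + h \<phi> * b \<phi> * cos \<phi> / sin \<phi>"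
    and radial: "\<And>\<phi>. \<phi> \<in> {0<..<pi/2} \<Longrightarrow>
      f2 \<phi> + f1 \<phi> * cos \<phi> / sin \<phi> = h \<phi> * f1 \<phi> - (f \<phi>)\<^sup>2 - (h \<phi>)\<^sup>2 + (b \<phi>)\<^sup>2 - 2 * P \<phi>"
    and x: "x \<in> {0<..<pi/2}"
  shows "b x = 0"
proof -
  have df: "(f has_real_derivative f1 \<phi>) (at \<phi>)" "(f1 has_real_derivative f2 \<phi>) (at \<phi>)"
    "(h has_real_derivative h1 \<phi>) (at \<phi>)" "(b has_real_derivative b1 \<phi>) (at \<phi>)" if "\<phi> \<in> {0<..<pi/2}" for \<phi>
    using d that unfolding twice_differentiable_with_def by auto
  have hb: "h \<phi> = 0 \<or> b \<phi> = 0" if \<phi>: "\<phi> \<in> {0<..<pi/2}" for \<phi>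
  proof -
    define N where "N = (\<lambda>\<phi>. (h \<phi>)\<^sup>2 * b \<phi> * sin \<phi>)"
    have "N \<phi> = N 0"
    proof (rule DERIV_isconst_end[where f = N and a = 0 and b = \<phi>])
      show "0 < \<phi>" using \<phi> by simp
      have "continuous_on {0..<pi/2} N" unfolding N_def by (intro continuous_intros cont)
      then show "continuous_on {0..\<phi>} N" using \<phi> by (elim continuous_on_subset) auto
      fix t assume "0 < t" "t < \<phi>"
      with \<phi> have t: "t \<in> {0<..<pi/2}" by auto
      have s: "sin t > 0" by (rule sin_pos_in_quadrant[OF t])
      have "(N has_real_derivative h t * (2 * h1 t * b t * sin t + (h t * b1 t) * sin t + h t * b t * cos t)) (at t)"
        unfolding N_def
        by (rule derivative_eq_intros df t refl)+ (simp add: power2_eq_square algebra_simps)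
      moreover have "2 * h1 t * b t * sin t + (h t * b1 t) * sin t + h t * b t * cos t = 0"
        unfolding div[OF t] ind[OF t] using s by (simp add: field_simps)
      ultimately show "(N has_real_derivative 0) (at t)" by simp
    qed
    then show ?thesis using sin_pos_in_quadrant[OF \<phi>] by (simp add: N_def)
  qed
  define Q where "Q = (\<lambda>\<phi>. (b \<phi>)\<^sup>2 * (sin \<phi>)\<^sup>2)"
  have dQ: "(Q has_real_derivative 0) (at \<phi>)" if \<phi>: "\<phi> \<in> {0<..<pi/2}" for \<phi>
  proof -
    have s: "sin \<phi> > 0" by (rule sin_pos_in_quadrant[OF \<phi>])
    have "(Q has_real_derivative 2 * b \<phi> * sin \<phi> * (b1 \<phi> * sin \<phi> + b \<phi> * cos \<phi>)) (at \<phi>)"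
      unfolding Q_def by (rule derivative_eq_intros df \<phi> refl)+ (simp add: power2_eq_square algebra_simps)
    moreover have "b \<phi> * (b1 \<phi> * sin \<phi> + b \<phi> * cos \<phi>) = 0" if b: "b \<phi> \<noteq> 0"
    proof -
      have "isCont b \<phi>" using df(4)[OF \<phi>] by (rule DERIV_isCont)
      then obtain T0 where T0: "open T0" "\<phi> \<in> T0" "\<And>t. t \<in> T0 \<Longrightarrow> b t \<noteq> 0"
        using b continuous_at_open[of \<phi> b] open_Compl[of "{0::real}"] by (metis ComplD ComplI closed_singleton singletonD singletonI)
      define T where "T = T0 \<inter> {0<..<pi/2}"
      have T: "open T" "\<phi> \<in> T" "\<And>t. t \<in> T \<Longrightarrow> t \<in> {0<..<pi/2}" "\<And>t. t \<in> T \<Longrightarrow> h t = 0"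
        using T0 \<phi> hb by (auto simp: T_def)
      have h1T: "h1 t = 0" if "t \<in> T" for t
        using locally_zero_derivative[OF df(3)[OF T(3)[OF that]] T(1) that T(4)] .
      have fT: "f t = 0" if "t \<in> T" for t using div[OF T(3)[OF that]] h1T[OF that] T(4)[OF that] by simp
      have f1T: "f1 t = 0" if "t \<in> T" for t
        using locally_zero_derivative[OF df(1)[OF T(3)[OF that]] T(1) that fT] .
      have f2T: "f2 t = 0" if "t \<in> T" for t
        using locally_zero_derivative[OF df(2)[OF T(3)[OF that]] T(1) that f1T] .
      have PT: "(b t)\<^sup>2 - 2 * P t = 0" if "t \<in> T" for t
        using radial[OF T(3)[OF that]] that by (simp add: T fT f1T f2T)
      have "((\<lambda>t. (b t)\<^sup>2 - 2 * P t) has_real_derivative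
         2 * b \<phi> * b1 \<phi> - 2 * (f1 \<phi> - h \<phi> * h1 \<phi> - (b \<phi>)\<^sup>2 * cos \<phi> / sin \<phi>)) (at \<phi>)"
        by (rule derivative_eq_intros df dP \<phi> refl)+ simp
      from locally_zero_derivative[OF this T(1,2) PT]
      show ?thesis using s by (simp add: T fT f1T field_simps power2_eq_square)
    qed
    ultimately show ?thesis by (cases "b \<phi> = 0") auto
  qed
  have "Q x = Q 0"
  proof (rule DERIV_isconst_end[where f = Q and a = 0 and b = x])
    show "0 < x" using x by simp
    have "continuous_on {0..<pi/2} Q" unfolding Q_def by (intro continuous_intros cont)
    then show "continuous_on {0..x} Q" using x by (elim continuous_on_subset) auto
    show "(Q has_real_derivative 0) (at t)" if "0 < t" "t < x" for t using dQ that x by simp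
  qed
  then show ?thesis using sin_pos_in_quadrant[OF x] by (simp add: Q_def)
qed

text \<open>Without swirl and magnetic field this is the problem of Slezkin and Landau: in the variable
\<open>z = cos \<phi>\<close> the stream function \<open>\<psi> = h sin \<phi>\<close> satisfies \<open>d\<psi>/dz = f\<close>, and the equations integrate three
times, to the Riccati equation
\<open>(1 - z\<^sup>2) d\<psi>/dz + 2 z \<psi> + \<psi>\<^sup>2 / 2 = K / 2 * (1 - z)\<^sup>2\<close>.
Regularity on the axis \<open>z = 1\<close> leaves only the one constant \<open>K\<close>.  At the equator \<open>z = 0\<close> one has \<open>\<psi> = 0\<close>, and
the remaining boundary condition is \<open>d\<psi>/dz = 0\<close> or \<open>d\<^sup>2\<psi>/dz\<^sup>2 = 0\<close>; either of them forces \<open>K = 0\<close>.  Then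
\<open>\<psi>\<close> solves a linear equation \<open>\<psi>' = k \<psi>\<close> with \<open>k\<close> bounded near the equator and zero data there.\<close>
lemma meridional_flow_vanishes:
  assumes cont: "continuous_on {0..pi/2} f" "continuous_on {0..pi/2} h" "continuous_on {0..<pi/2} f1"
    and d: "twice_differentiable_with f f1 f2" "twice_differentiable_with h h1 h2"
    and dP: "\<And>\<phi>. \<phi> \<in> {0<..<pi/2} \<Longrightarrow> (P has_real_derivative f1 \<phi> - h \<phi> * h1 \<phi>) (at \<phi>)"
    and div: "\<And>\<phi>. \<phi> \<in> {0<..<pi/2} \<Longrightarrow> h1 \<phi> = - f \<phi> - h \<phi> * cos \<phi> / sin \<phi>"
    and radial: "\<And>\<phi>. \<phi> \<in> {0<..<pi/2} \<Longrightarrow>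
      f2 \<phi> + f1 \<phi> * cos \<phi> / sin \<phi> = h \<phi> * f1 \<phi> - (f \<phi>)\<^sup>2 - (h \<phi>)\<^sup>2 - 2 * P \<phi>"
    and bc: "h (pi/2) = 0" "f (pi/2) = 0 \<or> (f1 \<longlongrightarrow> 0) (at_left (pi/2))"
    and x: "x \<in> {0<..<pi/2}"
  shows "f x = 0" "h x = 0"
proof -
  have df: "(f has_real_derivative f1 \<phi>) (at \<phi>)" "(f1 has_real_derivative f2 \<phi>) (at \<phi>)"
    "(h has_real_derivative h1 \<phi>) (at \<phi>)" if "\<phi> \<in> {0<..<pi/2}" for \<phi>
    using d that unfolding twice_differentiable_with_def by auto
  have "\<exists>K. \<forall>\<phi>\<in>{0<..<pi/2}. 2 * f \<phi> - (h \<phi>)\<^sup>2 - 2 * P \<phi> = K"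
  proof (rule has_field_derivative_zero_constant)
    fix \<phi> :: real assume \<phi>: "\<phi> \<in> {0<..<pi/2}"
    have "((\<lambda>\<phi>. 2 * f \<phi> - (h \<phi>)\<^sup>2 - 2 * P \<phi>) has_real_derivative 0) (at \<phi>)"
      by (rule derivative_eq_intros df dP \<phi> refl)+ simp
    then show "((\<lambda>\<phi>. 2 * f \<phi> - (h \<phi>)\<^sup>2 - 2 * P \<phi>) has_real_derivative 0) (at \<phi> within {0<..<pi/2})"
      by (rule DERIV_subset) simp
  qed simp
  then obtain K where K: "\<And>\<phi>. \<phi> \<in> {0<..<pi/2} \<Longrightarrow> 2 * f \<phi> - (h \<phi>)\<^sup>2 - 2 * P \<phi> = K" by blast
  define \<psi> where "\<psi> = (\<lambda>\<phi>. h \<phi> * sin \<phi>)"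
  have c\<psi>: "continuous_on {0..pi/2} \<psi>" unfolding \<psi>_def by (intro continuous_intros cont)
  have d\<psi>: "(\<psi> has_real_derivative - f \<phi> * sin \<phi>) (at \<phi>)" if \<phi>: "\<phi> \<in> {0<..<pi/2}" for \<phi>
    unfolding \<psi>_def using sin_pos_in_quadrant[OF \<phi>]
    by (auto intro!: derivative_eq_intros df \<phi> simp: div[OF \<phi>] field_simps)
  \<comment> \<open>The first integral \<open>(1 - z\<^sup>2) d\<^sup>2\<psi>/dz\<^sup>2 + 2 \<psi> + \<psi> d\<psi>/dz = K (z - 1)\<close>; \<open>f1\<close> is bounded at the axis, so the
    singular term contributes nothing there.\<close>
  define A where "A = (\<lambda>\<phi>. - sin \<phi> * f1 \<phi> + 2 * \<psi> \<phi> + \<psi> \<phi> * f \<phi> + K * (1 - cos \<phi>))"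
  have A0: "A \<phi> = 0" if \<phi>: "\<phi> \<in> {0<..<pi/2}" for \<phi>
  proof -
    have "A \<phi> = A 0"
    proof (rule DERIV_isconst_end[where f = A and a = 0 and b = \<phi>])
      show "0 < \<phi>" using \<phi> by simp
      have "continuous_on {0..<pi/2} A" unfolding A_def
        by (intro continuous_intros cont(3) continuous_on_subset[OF c\<psi>] continuous_on_subset[OF cont(1)]) auto
      then show "continuous_on {0..\<phi>} A" using \<phi> by (elim continuous_on_subset) auto
      fix t assume "0 < t" "t < \<phi>"
      with \<phi> have t: "t \<in> {0<..<pi/2}" by auto
      have s: "sin t > 0" by (rule sin_pos_in_quadrant[OF t])
      have r: "f2 t = h t * f1 t - (f t)\<^sup>2 + K - 2 * f t - f1 t * cos t / sin t"
        using radial[OF t] K[OF t] by simp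
      have "(A has_real_derivative - (cos t * f1 t) - sin t * f2 t - 2 * (f t * sin t) - f t * sin t * f t + \<psi> t * f1 t + K * sin t) (at t)"
        unfolding A_def by (rule derivative_eq_intros df d\<psi> t refl)+ (simp add: algebra_simps)
      moreover have "- (cos t * f1 t) - sin t * f2 t - 2 * (f t * sin t) - f t * sin t * f t + \<psi> t * f1 t + K * sin t = 0"
        unfolding r \<psi>_def using s by (simp add: field_simps power2_eq_square)
      ultimately show "(A has_real_derivative 0) (at t)" by simp
    qed
    then show ?thesis by (simp add: A_def \<psi>_def)
  qed
  \<comment> \<open>Twice the defect in the Riccati equation.\<close>
  define R where "R = (\<lambda>\<phi>. 2 * (sin \<phi>)\<^sup>2 * f \<phi> + 4 * cos \<phi> * \<psi> \<phi> + (\<psi> \<phi>)\<^sup>2 - K * (1 - cos \<phi>)\<^sup>2)"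
  have R0: "R \<phi> = 0" if \<phi>: "\<phi> \<in> {0<..pi/2}" for \<phi>
  proof -
    have "R \<phi> = R 0"
    proof (rule DERIV_isconst_end[where f = R and a = 0 and b = \<phi>])
      show "0 < \<phi>" using \<phi> by simp
      have "continuous_on {0..pi/2} R" unfolding R_def by (intro continuous_intros cont c\<psi>)
      then show "continuous_on {0..\<phi>} R" using \<phi> by (elim continuous_on_subset) auto
      fix t assume "0 < t" "t < \<phi>"
      with \<phi> have t: "t \<in> {0<..<pi/2}" by auto
      have "(R has_real_derivative - 2 * sin t * A t) (at t)"
        unfolding R_def A_def by (rule derivative_eq_intros df d\<psi> t refl)+ (simp add: power2_eq_square algebra_simps)
      then show "(R has_real_derivative 0) (at t)" by (simp add: A0[OF t])
    qed
    then show ?thesis by (simp add: R_def \<psi>_def)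
  qed
  have \<psi>lim: "(\<psi> \<longlongrightarrow> 0) (at_left (pi/2))"
    using continuous_on_Icc_at_leftD[OF c\<psi>] bc(1) by (simp add: \<psi>_def)
  have K0: "K = 0"
    using bc(2)
  proof
    assume "f (pi/2) = 0"
    with R0[of "pi/2"] bc(1) show ?thesis by (simp add: R_def \<psi>_def)
  next
    assume lim: "(f1 \<longlongrightarrow> 0) (at_left (pi/2))"
    have "(f \<longlongrightarrow> f (pi/2)) (at_left (pi/2))" using continuous_on_Icc_at_leftD[OF cont(1)] by simp
    then have "(A \<longlongrightarrow> - sin (pi/2) * 0 + 2 * 0 + 0 * f (pi/2) + K * (1 - cos (pi/2))) (at_left (pi/2))"
      unfolding A_def by (intro tendsto_intros lim \<psi>lim)
    moreover have "\<forall>\<^sub>F t in at_left (pi/2). A t = 0"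
    proof (rule eventually_mono)
      show "\<forall>\<^sub>F t in at_left (pi/2). t \<in> {0<..<pi/2}" by (rule eventually_at_left_real) simp
    qed (rule A0)
    then have "(A \<longlongrightarrow> 0) (at_left (pi/2))" by (rule tendsto_eventually)
    ultimately have "- sin (pi/2) * 0 + 2 * 0 + 0 * f (pi/2) + K * (1 - cos (pi/2)) = 0"
      by (intro tendsto_unique[of "at_left (pi/2)"]) simp_all
    then show ?thesis by simp
  qed
  obtain C where C: "\<And>\<phi>. \<phi> \<in> {0<..<pi/2} \<Longrightarrow> \<bar>\<psi> \<phi>\<bar> \<le> C"
    by (rule continuous_on_bounded_interior[OF c\<psi>]) blast
  have "\<psi> x = 0"
  proof (rule linear_ode_zero_at_end[OF _ _ \<psi>lim])
    \<comment> \<open>The coefficient is unbounded at the axis, so the interval must stay away from it.\<close>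
    show "x \<in> {x/2<..<pi/2}" using x by simp
    fix t assume "t \<in> {x/2<..<pi/2}"
    with x have t: "t \<in> {0<..<pi/2}" and xt: "x / 2 < t" by auto
    have s: "sin t > 0" by (rule sin_pos_in_quadrant[OF t])
    have "f t * sin t = - ((2 * cos t + \<psi> t / 2) / sin t * \<psi> t)"
      using R0[of t] t s K0 by (simp add: R_def field_simps power2_eq_square)
    then show "(\<psi> has_real_derivative (2 * cos t + \<psi> t / 2) / sin t * \<psi> t) (at t)"
      using d\<psi>[OF t] by simp
    have "\<bar>2 * cos t + \<psi> t / 2\<bar> \<le> 2 + C / 2"
      using C[OF t] cos_le_one[of t] cos_ge_minus_one[of t] by linarith
    moreover have "sin (x/2) \<le> sin t" using xt x t by (intro sin_monotone_2pi_le) auto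
    moreover have "sin (x/2) > 0" using x by (intro sin_pos_in_quadrant) auto
    ultimately show "\<bar>(2 * cos t + \<psi> t / 2) / sin t\<bar> \<le> (2 + C / 2) / sin (x/2)"
      unfolding abs_divide using s by (intro frac_le) auto
  qed
  with sin_pos_in_quadrant[OF x] show "h x = 0" by (simp add: \<psi>_def)
  with R0[of x] x K0 \<open>\<psi> x = 0\<close> sin_pos_in_quadrant[OF x] show "f x = 0" by (simp add: R_def)
qed

section \<open>Profiles and boundary conditions\<close>

lemma axisymmetric_homogeneous_has_profile:
  assumes axi: "axisymmetric v" and hom: "\<forall>c>0. \<forall>x\<in>half_space. v x = c *\<^sub>R v (c *\<^sub>R x)"
  shows "has_profile v (\<lambda>\<phi>. e_rho 0 \<phi> \<bullet> v (e_rho 0 \<phi>)) (\<lambda>\<phi>. e_theta 0 \<bullet> v (e_rho 0 \<phi>)) (\<lambda>\<phi>. e_phi 0 \<phi> \<bullet> v (e_rho 0 \<phi>))"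
proof -
  obtain a b c where rep: "\<And>\<rho> \<theta> \<phi>. \<rho> > 0 \<Longrightarrow> 0 \<le> \<phi> \<Longrightarrow> \<phi> < pi / 2 \<Longrightarrow>
      v (spherical \<rho> \<theta> \<phi>) = frame \<theta> \<phi> (a \<rho> \<phi>) (b \<rho> \<phi>) (c \<rho> \<phi>)"
    using axi unfolding axisymmetric_def frame_def by blast
  show ?thesis
    unfolding has_profile_def
  proof (intro allI impI, elim conjE)
    fix \<rho> \<theta> \<phi> :: real assume \<rho>: "\<rho> > 0" and \<phi>: "0 \<le> \<phi>" "\<phi> < pi / 2"
    have sphere: "v (e_rho \<theta> \<phi>) = frame \<theta> \<phi> (a 1 \<phi>) (b 1 \<phi>) (c 1 \<phi>)" for \<theta>
      using rep[of 1 \<phi> \<theta>] \<phi> by (simp add: spherical_eq_e_rho)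
    have "spherical \<rho> \<theta> \<phi> \<in> half_space"
      unfolding spherical_eq_e_rho using \<rho> \<phi> by (intro scaleR_half_space e_rho_half_space) auto
    from hom[rule_format, of "1 / \<rho>", OF _ this] \<rho>
    have "v (spherical \<rho> \<theta> \<phi>) = (1 / \<rho>) *\<^sub>R v (e_rho \<theta> \<phi>)" by (simp add: spherical_eq_e_rho)
    then show "v (spherical \<rho> \<theta> \<phi>) = (1 / \<rho>) *\<^sub>R frame \<theta> \<phi> (e_rho 0 \<phi> \<bullet> v (e_rho 0 \<phi>))
        (e_theta 0 \<bullet> v (e_rho 0 \<phi>)) (e_phi 0 \<phi> \<bullet> v (e_rho 0 \<phi>))"
      by (simp add: sphere inner_frame)
  qed
qed

lemma has_profile_cong:
  "has_profile v f g h \<Longrightarrow> (\<And>\<phi>. \<phi> \<in> {0..<pi/2} \<Longrightarrow> f \<phi> = f' \<phi> \<and> g \<phi> = g' \<phi> \<and> h \<phi> = h' \<phi>) \<Longrightarrow> has_profile v f' g' h'"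
  unfolding has_profile_def by auto

lemma closure_half_space: "closure half_space = {x. x $ 3 \<ge> 0}"
  unfolding half_space_def using closure_halfspace_component_gt[of 0 3] by simp

lemma equator_boundary: "e_rho 0 (pi/2) \<in> boundary"
  unfolding boundary_def frontier_def interior_open[OF open_half_space] closure_half_space
  by (simp add: half_space_def e_rho_def vector_3 vec_eq_iff forall_3)

lemma outward_normal_at_equator: "e_phi 0 (pi/2) = outward_normal"
  by (simp add: e_phi_def outward_normal_def vec_eq_iff forall_3 vector_3)

lemma meridian_continuous: "continuous_on S (e_rho \<theta>)" "continuous_on S (e_phi \<theta>)"
  by (intro continuous_at_imp_continuous_on ballI has_vector_derivative_continuous,
      rule e_rho_derivative_phi e_phi_derivative_phi)+

lemma extension_along_meridian:
  assumes "extends_continuously_to F E"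
  shows "continuous_on {0..pi/2} (\<lambda>\<phi>. E (e_rho 0 \<phi>))"
    and "\<phi> \<in> {0..<pi/2} \<Longrightarrow> E (e_rho 0 \<phi>) = F (e_rho 0 \<phi>)"
proof -
  have "e_rho 0 ` {0..pi/2} \<subseteq> closure half_space - {0}"
  proof safe
    fix \<phi> :: real assume "\<phi> \<in> {0..pi/2}"
    then show "e_rho 0 \<phi> \<in> closure half_space"
      by (auto simp: closure_half_space e_rho_def vector_3 intro!: cos_ge_zero)
    show "e_rho 0 \<phi> = 0 \<Longrightarrow> False" using frame_orthonormal(1)[of 0 \<phi>] by simp
  qed
  then show "continuous_on {0..pi/2} (\<lambda>\<phi>. E (e_rho 0 \<phi>))"
    using assms unfolding extends_continuously_to_def
    by (intro continuous_on_compose2[OF _ meridian_continuous(1)]) auto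
  show "\<phi> \<in> {0..<pi/2} \<Longrightarrow> E (e_rho 0 \<phi>) = F (e_rho 0 \<phi>)"
    using assms e_rho_half_space[of \<phi> 0] unfolding extends_continuously_to_def by auto
qed

lemma limit_at_equator:
  fixes k l :: "real \<Rightarrow> real"
  assumes "continuous_on {0..pi/2} k" "\<And>\<phi>. \<phi> \<in> {0<..<pi/2} \<Longrightarrow> l \<phi> = k \<phi>"
  shows "(l \<longlongrightarrow> k (pi/2)) (at_left (pi/2))"
proof -
  have "(k \<longlongrightarrow> k (pi/2)) (at_left (pi/2))" using continuous_on_Icc_at_leftD[OF assms(1)] by simp
  moreover have "\<forall>\<^sub>F \<phi> in at_left (pi/2). k \<phi> = l \<phi>"
  proof (rule eventually_mono)
    show "\<forall>\<^sub>F t in at_left (pi/2). t \<in> {0<..<pi/2}" by (rule eventually_at_left_real) simp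
  qed (simp add: assms(2))
  ultimately show ?thesis by (rule Lim_transform_eventually)
qed

text \<open>At the equator \<open>\<phi> = pi / 2\<close> the vector \<open>e_phi\<close> is the outward normal \<open>n\<close>, while \<open>e_rho\<close> and \<open>e_theta\<close> are
tangential.  The normal component of the derivative in a tangential direction \<open>\<tau>\<close> vanishes there: it is the
limit of \<open>- h\<close> for the radial direction and of \<open>- g cot \<phi>\<close> for the azimuthal one.  The stress condition
therefore reduces to \<open>\<tau> \<bullet> (\<nabla>u n) = 0\<close>, and these two components are the limits of \<open>f1 - h\<close> and \<open>g1\<close>.\<close>
lemma navier_slip_profile:
  assumes sm: "smooth_on half_space u" and pr: "has_profile u f g h"
    and d: "twice_differentiable_with f f1 f2" "twice_differentiable_with g g1 g2" "twice_differentiable_with h h1 h2"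
    and cont: "continuous_on {0..pi/2} g" "continuous_on {0..pi/2} h" and h0: "h (pi/2) = 0"
    and G: "extends_continuously_to (\<lambda>x. jacobian u (at x)) G"
    and bc: "\<And>\<tau>. norm \<tau> = 1 \<Longrightarrow> \<tau> \<bullet> outward_normal = 0 \<Longrightarrow>
       (strain (G (e_rho 0 (pi/2))) *v outward_normal) \<bullet> \<tau> = 0"
  shows "(f1 \<longlongrightarrow> 0) (at_left (pi/2))" "(g1 \<longlongrightarrow> 0) (at_left (pi/2))"
proof -
  define M where "M = G (e_rho 0 (pi/2))"
  have cG: "continuous_on {0..pi/2} (\<lambda>\<phi>. a \<phi> \<bullet> (G (e_rho 0 \<phi>) *v c \<phi>))"
    if "continuous_on {0..pi/2} a" "continuous_on {0..pi/2} c" for a c :: "real \<Rightarrow> real^3"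
    unfolding inner_vec_def matrix_vector_mult_def
    by (simp, intro continuous_intros that extension_along_meridian(1)[OF G])
  have D: "G (e_rho 0 \<phi>) *v a = directional a u (e_rho 0 \<phi>)" if "\<phi> \<in> {0<..<pi/2}" for a \<phi>
  proof -
    have m: "e_rho 0 \<phi> \<in> half_space" using that by (intro e_rho_half_space) auto
    note diff = smooth_on_differentiable[OF sm m]
    have "(u has_derivative (\<lambda>a. jacobian u (at (e_rho 0 \<phi>)) *v a)) (at (e_rho 0 \<phi>))"
      using diff jacobian_works by blast
    then have "(\<lambda>a. jacobian u (at (e_rho 0 \<phi>)) *v a) = frechet_derivative u (at (e_rho 0 \<phi>))"
      by (rule frechet_derivative_at)
    moreover have "G (e_rho 0 \<phi>) = jacobian u (at (e_rho 0 \<phi>))"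
      using extension_along_meridian(2)[OF G, of \<phi>] that by simp
    ultimately show ?thesis by (metis directional_eq_frechet_derivative[OF diff])
  qed
  note P = profile_derivatives[OF sm pr _ d, of _ 0]
  note mc = meridian_continuous[of "{0..pi/2}" 0]
  have equator: "e_phi 0 (pi/2) = outward_normal" "e_rho 0 (pi/2) \<bullet> outward_normal = 0"
    "e_theta 0 \<bullet> outward_normal = 0" "norm (e_rho 0 (pi/2)) = 1" "norm (e_theta 0) = 1"
    using frame_orthonormal(1)[of 0 "pi/2"] frame_orthonormal(2)[of 0] frame_orthonormal(5)[of 0 "pi/2"] frame_orthonormal(6)[of 0 "pi/2"]
    by (simp_all add: outward_normal_at_equator norm_eq_1)
  have ct: "continuous_on {0..pi/2} (\<lambda>_. e_theta 0)" by simp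
  have nr: "outward_normal \<bullet> (M *v e_rho 0 (pi/2)) = 0"
  proof (rule tendsto_unique)
    show "((\<lambda>\<phi>. - h \<phi>) \<longlongrightarrow> outward_normal \<bullet> (M *v e_rho 0 (pi/2))) (at_left (pi/2))"
      unfolding M_def equator(1)[symmetric]
      by (rule limit_at_equator[OF cG[OF mc(2,1)]]) (simp add: D P inner_frame)
    show "((\<lambda>\<phi>. - h \<phi>) \<longlongrightarrow> 0) (at_left (pi/2))"
      using continuous_on_Icc_at_leftD[OF cont(2)] h0 tendsto_minus by fastforce
  qed simp
  have nt: "outward_normal \<bullet> (M *v e_theta 0) = 0"
  proof (rule tendsto_unique)
    show "((\<lambda>\<phi>. - g \<phi> * cos \<phi> / sin \<phi>) \<longlongrightarrow> outward_normal \<bullet> (M *v e_theta 0)) (at_left (pi/2))"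
      unfolding M_def equator(1)[symmetric]
      by (rule limit_at_equator[OF cG[OF mc(2) ct]]) (simp add: D P inner_frame)
    have "(g \<longlongrightarrow> g (pi/2)) (at_left (pi/2))" using continuous_on_Icc_at_leftD[OF cont(1)] by simp
    then have "((\<lambda>\<phi>. - g \<phi> * cos \<phi> / sin \<phi>) \<longlongrightarrow> - g (pi/2) * cos (pi/2) / sin (pi/2)) (at_left (pi/2))"
      by (intro tendsto_intros) auto
    then show "((\<lambda>\<phi>. - g \<phi> * cos \<phi> / sin \<phi>) \<longlongrightarrow> 0) (at_left (pi/2))" by simp
  qed simp
  have str: "\<tau> \<bullet> (M *v outward_normal) = - (outward_normal \<bullet> (M *v \<tau>))"
    if "norm \<tau> = 1" "\<tau> \<bullet> outward_normal = 0" for \<tau>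
  proof -
    have "strain M *v outward_normal = (1/2) *\<^sub>R (M *v outward_normal + transpose M *v outward_normal)"
      by (simp add: strain_def scaleR_matrix_vector_assoc[symmetric] matrix_vector_mult_add_rdistrib)
    moreover have "(transpose M *v outward_normal) \<bullet> \<tau> = outward_normal \<bullet> (M *v \<tau>)"
      by (simp add: dot_lmul_matrix)
    ultimately show ?thesis
      using bc[OF that, folded M_def] by (simp add: inner_add_left inner_commute[of \<tau>])
  qed
  have "(f1 \<longlongrightarrow> e_rho 0 (pi/2) \<bullet> (G (e_rho 0 (pi/2)) *v e_phi 0 (pi/2)) + h (pi/2)) (at_left (pi/2))"
    by (rule limit_at_equator[OF continuous_on_add[OF cG[OF mc] cont(2)]]) (simp add: D P inner_frame)
  then show "(f1 \<longlongrightarrow> 0) (at_left (pi/2))"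
    using str[OF equator(4,2)] nr h0 by (simp add: equator(1) flip: M_def)
  have "(g1 \<longlongrightarrow> e_theta 0 \<bullet> (G (e_rho 0 (pi/2)) *v e_phi 0 (pi/2))) (at_left (pi/2))"
    by (rule limit_at_equator[OF cG[OF ct mc(2)]]) (simp add: D P inner_frame)
  then show "(g1 \<longlongrightarrow> 0) (at_left (pi/2))"
    using str[OF equator(5,3)] nt by (simp add: equator(1) flip: M_def)
qed

lemma zero_at_axis:
  fixes k :: "real \<Rightarrow> real"
  assumes "continuous_on {0..<pi/2} k" "\<And>\<phi>. \<phi> \<in> {0<..<pi/2} \<Longrightarrow> k \<phi> = 0" "\<phi> \<in> {0..<pi/2}"
  shows "k \<phi> = 0"
proof (cases "\<phi> = 0")
  case True
  have "continuous_on {0..pi/4} k" using assms(1) by (rule continuous_on_subset) (auto, use pi_gt_zero in linarith)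
  then have "(k \<longlongrightarrow> k 0) (at_right 0)" using continuous_on_Icc_at_rightD[of 0 "pi/4" k] by simp
  moreover have "(k \<longlongrightarrow> 0) (at_right 0)"
  proof (rule tendsto_eventually, rule eventually_mono)
    show "\<forall>\<^sub>F t in at_right 0. t \<in> {0<..<pi/2}" by (rule eventually_at_right_real) simp
  qed (rule assms(2))
  ultimately have "k 0 = 0" by (intro tendsto_unique[of "at_right (0::real)"]) simp_all
  then show ?thesis using True by simp
qed (use assms in auto)

lemma profile_zero_imp_zero:
  assumes "has_profile v f g h" "\<And>\<phi>. \<phi> \<in> {0..<pi/2} \<Longrightarrow> f \<phi> = 0 \<and> g \<phi> = 0 \<and> h \<phi> = 0" "x \<in> half_space"
  shows "v x = 0"
proof -
  obtain \<rho> \<theta> \<phi> where "\<rho> > 0" "0 \<le> \<phi>" "\<phi> < pi / 2" "x = spherical \<rho> \<theta> \<phi>"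
    using half_space_spherical[OF assms(3)] .
  with assms(1,2) show ?thesis by (simp add: has_profile_def frame_def)
qed

section \<open>Vanishing of the solution\<close>

theorem theorem1p2:
  fixes u B :: "real^3 \<Rightarrow> real^3" and p :: "real^3 \<Rightarrow> real"
  assumes "smooth_on half_space u" and "smooth_on half_space B" and "smooth_on half_space p"
    and "axisymmetric u" and "axisymmetric B"
    and "self_similar u B p"
    and "stationary_mhd u B p"
    and "no_slip u B \<or> navier_slip u B"
    and "\<exists>b :: real \<Rightarrow> real. \<forall>\<rho> \<theta> \<phi>. \<rho> > 0 \<and> 0 \<le> \<phi> \<and> \<phi> < pi / 2 \<longrightarrow>
           B (spherical \<rho> \<theta> \<phi>) = (b \<phi> / \<rho>) *\<^sub>R e_theta \<theta>"
  shows "\<forall>x\<in>half_space. u x = 0 \<and> B x = 0"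
proof -
  note sm = assms(1-3)
  have hom: "\<forall>c>0. \<forall>x\<in>half_space. u x = c *\<^sub>R u (c *\<^sub>R x)" "\<forall>c>0. \<forall>x\<in>half_space. p x = c\<^sup>2 * p (c *\<^sub>R x)"
    using assms(6) unfolding self_similar_def by blast+
  obtain b where "\<And>\<rho> \<theta> \<phi>. \<rho> > 0 \<and> 0 \<le> \<phi> \<and> \<phi> < pi / 2 \<longrightarrow> B (spherical \<rho> \<theta> \<phi>) = (b \<phi> / \<rho>) *\<^sub>R e_theta \<theta>"
    using assms(9) by blast
  then have prB: "has_profile B (\<lambda>_. 0) b (\<lambda>_. 0)"
    by (simp add: has_profile_def frame_def)
  obtain U where U: "extends_continuously_to u U" "U (e_rho 0 (pi/2)) \<bullet> outward_normal = 0"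
    and slip: "U (e_rho 0 (pi/2)) = 0 \<or> (\<exists>G. extends_continuously_to (\<lambda>x. jacobian u (at x)) G \<and>
      (\<forall>\<tau>. norm \<tau> = 1 \<and> \<tau> \<bullet> outward_normal = 0 \<longrightarrow> (strain (G (e_rho 0 (pi/2))) *v outward_normal) \<bullet> \<tau> = 0))"
    using assms(8) equator_boundary unfolding no_slip_def navier_slip_def by (metis inner_zero_left)
  \<comment> \<open>Components of the extension \<open>U\<close> rather than of \<open>u\<close>, so that they are continuous up to the equator.\<close>
  define f where "f = (\<lambda>\<phi>. e_rho 0 \<phi> \<bullet> U (e_rho 0 \<phi>))"
  define g where "g = (\<lambda>\<phi>. e_theta 0 \<bullet> U (e_rho 0 \<phi>))"
  define h where "h = (\<lambda>\<phi>. e_phi 0 \<phi> \<bullet> U (e_rho 0 \<phi>))"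
  note ext = extension_along_meridian[OF U(1)]
  have prU: "has_profile u f g h"
    by (rule has_profile_cong[OF axisymmetric_homogeneous_has_profile[OF assms(4) hom(1)]])
      (simp_all add: f_def g_def h_def ext(2))
  have cont: "continuous_on {0..pi/2} f" "continuous_on {0..pi/2} g" "continuous_on {0..pi/2} h"
    unfolding f_def g_def h_def by (intro continuous_intros meridian_continuous ext(1))+
  obtain f1 f2 g1 g2 h1 h2 where d: "twice_differentiable_with f f1 f2"
    "twice_differentiable_with g g1 g2" "twice_differentiable_with h h1 h2"
    and contu: "continuous_on {0..<pi/2} f" "continuous_on {0..<pi/2} g" "continuous_on {0..<pi/2} h" "continuous_on {0..<pi/2} f1"
    using profile_twice_differentiable[OF sm(1) prU] by metis
  obtain b1 b2 where db: "twice_differentiable_with b b1 b2" and contb: "continuous_on {0..<pi/2} b"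
    using profile_twice_differentiable[OF sm(2) prB] by metis
  have h0: "h (pi/2) = 0"
    using U(2) by (simp add: h_def outward_normal_at_equator inner_commute)
  have bc: "(f (pi/2) = 0 \<and> g (pi/2) = 0) \<or> ((f1 \<longlongrightarrow> 0) (at_left (pi/2)) \<and> (g1 \<longlongrightarrow> 0) (at_left (pi/2)))"
    using slip
  proof
    assume "U (e_rho 0 (pi/2)) = 0"
    then show ?thesis by (simp add: f_def g_def)
  next
    assume "\<exists>G. extends_continuously_to (\<lambda>x. jacobian u (at x)) G \<and>
      (\<forall>\<tau>. norm \<tau> = 1 \<and> \<tau> \<bullet> outward_normal = 0 \<longrightarrow> (strain (G (e_rho 0 (pi/2))) *v outward_normal) \<bullet> \<tau> = 0)"
    then show ?thesis using navier_slip_profile[OF sm(1) prU d cont(2,3) h0] by blast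
  qed
  define P where "P = (\<lambda>\<phi>. p (e_rho 0 \<phi>))"
  note eqs = mhd_profile_equations[OF sm hom(2) assms(7) prU prB d db]
  have g0: "g \<phi> = 0" if "\<phi> \<in> {0<..<pi/2}" for \<phi>
    using bc by (intro swirl_vanishes[OF cont(2,3) d(2) eqs(3) _ that]) auto
  have dP: "(P has_real_derivative f1 \<phi> - h \<phi> * h1 \<phi> - (b \<phi>)\<^sup>2 * cos \<phi> / sin \<phi>) (at \<phi>)"
    if \<phi>: "\<phi> \<in> {0<..<pi/2}" for \<phi>
    using pressure_derivatives(2)[OF sm(3) hom(2) \<phi>, of 0] g0[OF \<phi>]
      polar_pressure_gradient[where f = f and g = g and h = h and b = b and \<phi> = \<phi>,
        OF d(1,3) eqs(1) eqs(5)[OF \<phi>] \<phi>]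
    by (simp add: P_def)
  have radial: "f2 \<phi> + f1 \<phi> * cos \<phi> / sin \<phi> = h \<phi> * f1 \<phi> - (f \<phi>)\<^sup>2 - (h \<phi>)\<^sup>2 + (b \<phi>)\<^sup>2 - 2 * P \<phi>"
    if "\<phi> \<in> {0<..<pi/2}" for \<phi>
    using eqs(4)[OF that] g0[OF that] by (simp add: P_def)
  have b0: "b \<phi> = 0" if "\<phi> \<in> {0<..<pi/2}" for \<phi>
    by (rule magnetic_profile_vanishes[OF contu(3) contb d(1,3) db dP eqs(1,2) radial that])
  have dP0: "(P has_real_derivative f1 \<phi> - h \<phi> * h1 \<phi>) (at \<phi>)" if "\<phi> \<in> {0<..<pi/2}" for \<phi>
    using dP[OF that] b0[OF that] by simp
  have radial0: "f2 \<phi> + f1 \<phi> * cos \<phi> / sin \<phi> = h \<phi> * f1 \<phi> - (f \<phi>)\<^sup>2 - (h \<phi>)\<^sup>2 - 2 * P \<phi>"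
    if "\<phi> \<in> {0<..<pi/2}" for \<phi>
    using radial[OF that] b0[OF that] by simp
  have bcf: "f (pi/2) = 0 \<or> (f1 \<longlongrightarrow> 0) (at_left (pi/2))" using bc by blast
  have fh0: "f \<phi> = 0" "h \<phi> = 0" if "\<phi> \<in> {0<..<pi/2}" for \<phi>
    using meridional_flow_vanishes[OF cont(1,3) contu(4) d(1,3) dP0 eqs(1) radial0 h0 bcf that] by blast+
  show ?thesis
  proof (intro ballI conjI)
    fix x assume x: "x \<in> half_space"
    show "u x = 0"
      using profile_zero_imp_zero[OF prU _ x] zero_at_axis[OF contu(1) fh0(1)] zero_at_axis[OF contu(2) g0]
        zero_at_axis[OF contu(3) fh0(2)] by blast
    show "B x = 0"
      using profile_zero_imp_zero[OF prB _ x] zero_at_axis[OF contb b0] by blast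
  qed
qed

end
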